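(* Let $r\geq 2$ be an integer and let $p\geq r$ be a prime number. Let $\mathcal H$ be an $r$-uniform hypergraph and let $c:V(\mathcal H)\to[C]$ be a proper coloring of $\mathcal H$ ($C$ an arbitrary positive integer). Then the following hold. (i) $\mathcal H$ contains a colorful (with respect to $c$) balanced complete $r$-uniform $p$-partite subhypergraph with $\mathrm{ind}_{\mathbb Z_p}(B_0(\mathcal H,\mathbb Z_p))+1$ vertices. In particular, $$\chi(\mathcal H)\geq \frac{\mathrm{ind}_{\mathbb Z_p}(B_0(\mathcal H,\mathbb Z_p))+1}{r-1}.$$ (ii) If $p\leq\omega(\mathcal H)$, then $\mathcal H$ contains a colorful (with respect to $c$) balanced complete $r$-uniform $p$-partite subhypergraph with $\mathrm{Xind}_{\mathbb Z_p}(\mathrm{Hom}(K^r_p,\mathcal H))+p$ vertices. In particular, $$\chi(\mathcal H)\geq \frac{\mathrm{Xind}_{\mathbb Z_p}(\mathrm{Hom}(K^r_p,\mathcal H))+p}{r-1}.$$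
   Context: Hypergraphs. A hypergraph $\mathcal H$ has a finite vertex set $V(\mathcal H)$ and an edge set $E(\mathcal H)$ which is a family of nonempty subsets of $V(\mathcal H)$; it is $r$-uniform if all edges have size $r$. For pairwise disjoint $U_1,\dots,U_q\subseteq V(\mathcal H)$, $\mathcal H[U_1,\dots,U_q]$ is the hypergraph with vertex set $\bigcup_i U_i$ and edge set $\{e\in E(\mathcal H): e\subseteq\bigcup_iU_i,\ |e\cap U_i|\leq 1\ \forall i\in[q]\}$. For $\mathcal H$ $r$-uniform and $q\ge r$ it is an $r$-uniform $q$-partite hypergraph with parts $U_1,\dots,U_q$ (some parts may be empty); it is complete if it contains every $r$-subset of $\bigcup_iU_i$ meeting each $U_i$ in at most one vertex, and balanced if $\big||U_i|-|U_j|\big|\leq1$ for all $i,j$. $K^r_n=([n],\binom{[n]}{r})$, and $\omega(\mathcal H)$ is the largest $n$ such that $\mathcal H$ contains $K^r_n$ as a subhypergraph. A proper coloring is a map on $V(\mathcal H)$ with no monochromatic edge; $\chi(\mathcal H)$ is the minimum number of colors in a proper coloring. Given a proper coloring $c$, $\mathcal H[U_1,\dots,U_q]$ is colorful if for each $j$ the vertices of $U_j$ get pairwise distinct colors. Thus a "colorful balanced complete $r$-uniform $p$-partite subhypergraph in $\mathcal H$ with $N$ vertices" is some $\mathcal H[U_1,\dots,U_p]$ that is colorful, balanced, complete, with $\sum_i|U_i|=N$. Index. $\mathbb Z_p=\{\omega^1,\dots,\omega^p\}$ is the cyclic group of order $p$ with generator $\omega$. A simplicial $\mathbb Z_p$-complex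 is a simplicial complex with a $\mathbb Z_p$-action on its vertices by simplicial maps; it is free if no non-identity element fixes a simplex. $E_n\mathbb Z_p$ denotes any free $(n-1)$-connected $n$-dimensional simplicial $\mathbb Z_p$-complex, e.g. the $(n+1)$-fold join $\mathbb Z_p^{*(n+1)}$. For a $\mathbb Z_p$-space $X$, $\mathrm{ind}_{\mathbb Z_p}(X)$ is the least $n$ such that there is a continuous $\mathbb Z_p$-equivariant map $X\to E_n\mathbb Z_p$ (independent of the choice of $E_n\mathbb Z_p$); for a simplicial complex $K$, $\mathrm{ind}_{\mathbb Z_p}(K)$ means $\mathrm{ind}_{\mathbb Z_p}(\|K\|)$, with $\|K\|$ the geometric realization. Box complex. $B_0(\mathcal H,\mathbb Z_p)$ is the simplicial complex with vertex set $\mathbb Z_p\times V(\mathcal H)$ whose simplices are all sets $\{\omega^1\}\times U_1\cup\dots\cup\{\omega^p\}\times U_p$ with $U_1,\dots,U_p$ pairwise disjoint subsets of $V(\mathcal H)$, $\bigcup_iU_i\neq\varnothing$, and $\mathcal H[U_1,\dots,U_p]$ a complete $r$-uniform $p$-partite hypergraph (some $U_i$ may be empty; if fewer than $r$ of the $U_i$ are nonempty, completeness holds vacuously). $\mathbb Z_p$ acts freely by $\epsilon\cdot(\epsilon',v)=(\epsilon\epsilon',v)$. Cross-index. A $\mathbb Z_p$-poset is a poset on which $\mathbb Z_p$ acts by order automorphisms; it is free if non-identity elements have no fixed points. $Q_{n,p}$ is the free $\mathbb Z_p$-poset on $\mathbb Z_p\times[n+1]$ with $(\epsilon,i)<(\epsilon',j)$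 iff $i<j$ and action $\epsilon\cdot(\epsilon',j)=(\epsilon\epsilon',j)$. $\mathrm{Xind}_{\mathbb Z_p}(P)$ is the least $n$ such that there is an order-preserving $\mathbb Z_p$-equivariant map $P\to Q_{n,p}$. Hom complex. $\mathrm{Hom}(K^r_p,\mathcal H)$ is the free $\mathbb Z_p$-poset of all ordered $p$-tuples $(U_1,\dots,U_p)$ of nonempty pairwise disjoint subsets of $V(\mathcal H)$ such that $\mathcal H[U_1,\dots,U_p]$ is a complete $r$-uniform $p$-partite hypergraph, ordered by $(U_1,\dots,U_p)\preceq(U'_1,\dots,U'_p)$ iff $U_i\subseteq U'_i$ for all $i$, with action $\omega^i\cdot(U_1,\dots,U_p)=(U_{1+i},\dots,U_{p+i})$, where $U_j=U_{j-p}$ for $j>p$. *)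

theory Defs
  imports
    "HOL-Analysis.Analysis"
    "HOL-Algebra.Elementary_Groups"
    "HOL-Computational_Algebra.Primes"
begin

section \<open>Hypergraphs\<close>

record 'v hypergraph =
  verts :: "'v set"
  edges :: "'v set set"

definition hypergraph :: "'v hypergraph \<Rightarrow> bool" where
  "hypergraph H \<longleftrightarrow> finite (verts H) \<and> (\<forall>e\<in>edges H. e \<noteq> {} \<and> e \<subseteq> verts H)"

definition uniform :: "nat \<Rightarrow> 'v hypergraph \<Rightarrow> bool" where
  "uniform r H \<longleftrightarrow> (\<forall>e\<in>edges H. card e = r)"

definition proper_coloring :: "'v hypergraph \<Rightarrow> ('v \<Rightarrow> nat) \<Rightarrow> bool" where
  "proper_coloring H c \<longleftrightarrow> (\<forall>e\<in>edges H. \<not> (\<exists>a. \<forall>v\<in>e. c v = a))"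

definition chromatic_number :: "'v hypergraph \<Rightarrow> nat" where
  "chromatic_number H = (LEAST k. \<exists>c \<in> verts H \<rightarrow> {1..k}. proper_coloring H c)"

definition complete_hypergraph :: "nat \<Rightarrow> nat \<Rightarrow> nat hypergraph" where
  "complete_hypergraph r n = \<lparr>verts = {1..n}, edges = {e. e \<subseteq> {1..n} \<and> card e = r}\<rparr>"

definition contains_subhypergraph :: "'v hypergraph \<Rightarrow> 'w hypergraph \<Rightarrow> bool" where
  "contains_subhypergraph H G \<longleftrightarrow>
     (\<exists>f \<in> verts G \<rightarrow> verts H. inj_on f (verts G) \<and> (\<forall>e\<in>edges G. f ` e \<in> edges H))"

definition clique_number :: "nat \<Rightarrow> 'v hypergraph \<Rightarrow> nat" where
  "clique_number r H = Max {n. contains_subhypergraph H (complete_hypergraph r n)}"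

text \<open>The tuple \<open>(U\<^sub>1, \<dots>, U\<^sub>q)\<close> is a family \<open>U\<close> over an index set \<open>I\<close>: \<open>I\<close> is \<open>{1..p}\<close>, or the
  carrier of the cyclic group of order \<open>p\<close>.\<close>

definition partite_family :: "'v hypergraph \<Rightarrow> 'i set \<Rightarrow> ('i \<Rightarrow> 'v set) \<Rightarrow> bool" where
  "partite_family H I U \<longleftrightarrow> (\<forall>i\<in>I. U i \<subseteq> verts H) \<and> disjoint_family_on U I"

definition partite_sub :: "'v hypergraph \<Rightarrow> 'i set \<Rightarrow> ('i \<Rightarrow> 'v set) \<Rightarrow> 'v hypergraph" where
  "partite_sub H I U =
     \<lparr>verts = (\<Union>i\<in>I. U i),
      edges = {e \<in> edges H. e \<subseteq> (\<Union>i\<in>I. U i) \<and> (\<forall>i\<in>I. card (e \<inter> U i) \<le> 1)}\<rparr>"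

definition complete_partite :: "nat \<Rightarrow> 'v hypergraph \<Rightarrow> 'i set \<Rightarrow> ('i \<Rightarrow> 'v set) \<Rightarrow> bool" where
  "complete_partite r H I U \<longleftrightarrow>
     (\<forall>e. e \<subseteq> (\<Union>i\<in>I. U i) \<and> card e = r \<and> (\<forall>i\<in>I. card (e \<inter> U i) \<le> 1)
        \<longrightarrow> e \<in> edges (partite_sub H I U))"

definition balanced :: "'i set \<Rightarrow> ('i \<Rightarrow> 'v set) \<Rightarrow> bool" where
  "balanced I U \<longleftrightarrow> (\<forall>i\<in>I. \<forall>j\<in>I. \<bar>int (card (U i)) - int (card (U j))\<bar> \<le> 1)"

definition colorful :: "('v \<Rightarrow> nat) \<Rightarrow> 'i set \<Rightarrow> ('i \<Rightarrow> 'v set) \<Rightarrow> bool" where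
  "colorful c I U \<longleftrightarrow> (\<forall>j\<in>I. inj_on c (U j))"

definition has_colorful_balanced_complete_partite ::
    "nat \<Rightarrow> 'v hypergraph \<Rightarrow> ('v \<Rightarrow> nat) \<Rightarrow> nat \<Rightarrow> int \<Rightarrow> bool" where
  "has_colorful_balanced_complete_partite r H c p N \<longleftrightarrow>
     (\<exists>U :: nat \<Rightarrow> 'v set.
        partite_family H {1..p} U \<and> complete_partite r H {1..p} U \<and>
        balanced {1..p} U \<and> colorful c {1..p} U \<and>
        int (\<Sum>i=1..p. card (U i)) = N)"

section \<open>Actions of the cyclic group of order \<open>p\<close>\<close>

text \<open>The element \<open>\<omega>\<^sup>i\<close> is the residue of \<open>i\<close> in the library's additively written group on
  \<open>{0..<p}\<close>; in particular \<open>\<omega>\<^sup>p\<close> is \<open>0\<close>.\<close>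

abbreviation Zp :: "nat \<Rightarrow> int set" where
  "Zp p \<equiv> carrier (integer_mod_group p)"

definition equivariant ::
    "nat \<Rightarrow> 'a set \<Rightarrow> (int \<Rightarrow> 'a \<Rightarrow> 'a) \<Rightarrow> (int \<Rightarrow> 'b \<Rightarrow> 'b) \<Rightarrow> ('a \<Rightarrow> 'b) \<Rightarrow> bool" where
  "equivariant p A \<alpha> \<beta> f \<longleftrightarrow> (\<forall>\<epsilon>\<in>Zp p. \<forall>x\<in>A. f (\<alpha> \<epsilon> x) = \<beta> \<epsilon> (f x))"

text \<open>The action \<open>\<epsilon> \<cdot> (\<epsilon>', v) = (\<epsilon> \<epsilon>', v)\<close>, shared by all complexes and posets on a product with
  the group.\<close>

definition left_act :: "nat \<Rightarrow> int \<Rightarrow> int \<times> 'v \<Rightarrow> int \<times> 'v" where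
  "left_act p \<epsilon> = (\<lambda>(\<epsilon>', v). (\<epsilon> \<otimes>\<^bsub>integer_mod_group p\<^esub> \<epsilon>', v))"

section \<open>Geometric realization and index\<close>

text \<open>A simplicial complex is given by its set of nonempty simplices. Points of the realization
  are barycentric coordinate functions, vanishing off a simplex, with the topology of pointwise
  convergence; this is the usual topology of the realization for finite complexes, and all
  complexes below are finite.\<close>

definition realization :: "'a set set \<Rightarrow> ('a \<Rightarrow> real) topology" where
  "realization K = top_of_set
     {x. (\<forall>v. x v \<ge> 0) \<and> {v. x v \<noteq> 0} \<in> K \<and> (\<Sum>v | x v \<noteq> 0. x v) = 1}"

text \<open>The affine extension of a map on vertices.\<close>

definition realization_map :: "('a \<Rightarrow> 'b) \<Rightarrow> ('a \<Rightarrow> real) \<Rightarrow> ('b \<Rightarrow> real)" where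
  "realization_map f x = (\<lambda>w. \<Sum>v | x v \<noteq> 0 \<and> f v = w. x v)"

text \<open>The standard model of \<open>E\<^sub>n\<close>: the \<open>(n+1)\<close>-fold join of the discrete set \<open>Zp p\<close>, a simplex
  having at most one vertex in each copy. For \<open>n = -1\<close> it is the empty complex.\<close>

definition E_complex :: "nat \<Rightarrow> int \<Rightarrow> (int \<times> int) set set" where
  "E_complex p n = {\<sigma>. \<sigma> \<noteq> {} \<and> \<sigma> \<subseteq> Zp p \<times> {1..n+1} \<and> inj_on snd \<sigma>}"

text \<open>The index starts at \<open>-1\<close>, its value on the empty space. This matters for a hypergraph
  without vertices, whose box complex is empty.\<close>

definition Zp_index :: "nat \<Rightarrow> 'x topology \<Rightarrow> (int \<Rightarrow> 'x \<Rightarrow> 'x) \<Rightarrow> int" where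
  "Zp_index p X \<alpha> =
     (LEAST n::int. n \<ge> -1 \<and>
        (\<exists>f. continuous_map X (realization (E_complex p n)) f \<and>
             equivariant p (topspace X) \<alpha> (\<lambda>\<epsilon>. realization_map (left_act p \<epsilon>)) f))"

definition complex_index :: "nat \<Rightarrow> 'a set set \<Rightarrow> (int \<Rightarrow> 'a \<Rightarrow> 'a) \<Rightarrow> int" where
  "complex_index p K \<alpha> = Zp_index p (realization K) (\<lambda>\<epsilon>. realization_map (\<alpha> \<epsilon>))"

definition box_complex :: "nat \<Rightarrow> 'v hypergraph \<Rightarrow> nat \<Rightarrow> (int \<times> 'v) set set" where
  "box_complex r H p =
     {Sigma (Zp p) U | U. partite_family H (Zp p) U \<and> (\<Union>\<epsilon>\<in>Zp p. U \<epsilon>) \<noteq> {} \<and>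
                          complete_partite r H (Zp p) U}"

definition ind_box :: "nat \<Rightarrow> 'v hypergraph \<Rightarrow> nat \<Rightarrow> int" where
  "ind_box r H p = complex_index p (box_complex r H p) (left_act p)"

section \<open>Cross-index of posets with a cyclic group action\<close>

definition Q_poset :: "nat \<Rightarrow> int \<Rightarrow> (int \<times> int) set" where
  "Q_poset p n = Zp p \<times> {1..n+1}"

definition Q_le :: "int \<times> int \<Rightarrow> int \<times> int \<Rightarrow> bool" where
  "Q_le x y \<longleftrightarrow> x = y \<or> snd x < snd y"

definition cross_index ::
    "nat \<Rightarrow> 'a set \<Rightarrow> ('a \<Rightarrow> 'a \<Rightarrow> bool) \<Rightarrow> (int \<Rightarrow> 'a \<Rightarrow> 'a) \<Rightarrow> int" where
  "cross_index p P leq \<alpha> =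
     (LEAST n::int. n \<ge> -1 \<and>
        (\<exists>f \<in> P \<rightarrow> Q_poset p n. monotone_on P leq Q_le f \<and> equivariant p P \<alpha> (left_act p) f))"

text \<open>The \<open>p\<close>-tuples are indexed by \<open>Zp p\<close>, so that index \<open>p\<close> becomes \<open>0\<close> and cyclic shifts are
  translations; they are extensional functions, hence determined by their components.\<close>

definition Hom_poset :: "nat \<Rightarrow> 'v hypergraph \<Rightarrow> nat \<Rightarrow> (int \<Rightarrow> 'v set) set" where
  "Hom_poset r H p =
     {U \<in> extensional (Zp p). (\<forall>j\<in>Zp p. U j \<noteq> {}) \<and> partite_family H (Zp p) U \<and>
                              complete_partite r H (Zp p) U}"

definition Hom_le :: "nat \<Rightarrow> (int \<Rightarrow> 'v set) \<Rightarrow> (int \<Rightarrow> 'v set) \<Rightarrow> bool" where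
  "Hom_le p U U' \<longleftrightarrow> (\<forall>j\<in>Zp p. U j \<subseteq> U' j)"

definition Hom_act :: "nat \<Rightarrow> int \<Rightarrow> (int \<Rightarrow> 'v set) \<Rightarrow> (int \<Rightarrow> 'v set)" where
  "Hom_act p i U = restrict (\<lambda>j. U (j \<otimes>\<^bsub>integer_mod_group p\<^esub> i)) (Zp p)"

definition Xind_Hom :: "nat \<Rightarrow> 'v hypergraph \<Rightarrow> nat \<Rightarrow> int" where
  "Xind_Hom r H p = cross_index p (Hom_poset r H p) (Hom_le p) (Hom_act p)"

end

theory Submission
  imports Defs "HOL-Number_Theory.Cong"
begin

text \<open>
  The bridge between colourings and topology is elementary. Attach to each complete \<open>p\<close>-partite
  family \<open>U\<close> the tuple of colour sets \<open>c ` U j\<close>. Let \<open>m\<close> be the least size of these sets. The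
  \<^emph>\<open>level\<close> of \<open>U\<close> is the sum over \<open>j\<close> of the minimum of \<open>card (c ` U j)\<close> and \<open>m + 1\<close>. A balanced
  choice of subsets of the colour sets can have any total size up to the level
  (\<open>balanced_sizes\<close>); picking one vertex per chosen colour gives a colourful balanced complete
  subhypergraph with that many vertices (\<open>colourful_subfamily\<close>). So if there is none with \<open>N\<close>
  vertices, then all levels are less than \<open>N\<close>.

  The level is monotone and invariant under rotation of the parts. When it stays constant along
  \<open>U \<le> U'\<close>, then \<open>m\<close> and the colour sets of size \<open>m\<close> stay the same as well, so the
  tuple in which all other colour sets are replaced by one common symbol does not change
  (\<open>profile_eq_if_level_eq\<close>). This tuple is not constant: some set has size \<open>m\<close>, and if all of
  them were equal, a colour would occur in all \<open>p \<ge> r\<close> parts, which produces a monochromatic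
  edge. A nonconstant tuple indexed by residues modulo the prime \<open>p\<close> has an \<^emph>\<open>orientation\<close>: the
  centre of mass, computed modulo \<open>p\<close>, of the set of indices at which it takes a chosen value.
  Rotating the tuple shifts this residue accordingly. The pair of orientation and level is
  therefore an order-preserving equivariant map from the poset of families to the poset \<open>Q\<close> whose
  layers are the possible levels.

  For the Hom poset this bounds the cross-index directly; there the levels start at \<open>p\<close>, since no part
  is empty. For the box complex the map on the face poset is turned into a continuous equivariant
  map of realizations: a point determines a flag of simplices, namely the sets of vertices
  with large coordinates, and the members of the flag are sent to vertices in different layers of
  the join (\<open>equivariant_realization_map_exists\<close>).

  The bounds on the chromatic number follow by counting for an optimal colouring, because each
  colour occurs in at most \<open>r - 1\<close> parts and at most once in each.
\<close>

section \<open>Centres of mass of sets of residues\<close>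

lemma Zp_eq: "0 < p \<Longrightarrow> Zp p = {0..<int p}"
  by (simp add: carrier_integer_mod_group)

lemma finite_Zp: "0 < p \<Longrightarrow> finite (Zp p)"
  by (simp add: Zp_eq)

lemma card_Zp: "0 < p \<Longrightarrow> card (Zp p) = p"
  by (simp add: Zp_eq)

lemma bij_betw_shift:
  assumes "0 < p"
  shows "bij_betw (\<lambda>j. (j + \<epsilon>) mod int p) (Zp p) (Zp p)"
proof (rule bij_betw_byWitness[where f' = "\<lambda>j. (j - \<epsilon>) mod int p"])
  show "\<forall>a\<in>Zp p. ((a + \<epsilon>) mod int p - \<epsilon>) mod int p = a"
    using assms by (auto simp: Zp_eq mod_diff_left_eq)
  show "\<forall>a\<in>Zp p. ((a - \<epsilon>) mod int p + \<epsilon>) mod int p = a"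
    using assms by (auto simp: Zp_eq mod_add_left_eq)
qed (use assms in \<open>auto simp: Zp_eq\<close>)

definition barycentre :: "nat \<Rightarrow> int set \<Rightarrow> int" where
  "barycentre p T = (THE s. s \<in> Zp p \<and> [int (card T) * s = \<Sum>T] (mod int p))"

text \<open>The number of elements of a proper nonempty set of residues is invertible modulo a prime,
  so the sum of the elements can be divided by it. This is where primality of \<open>p\<close> enters.\<close>

lemma ex1_barycentre:
  assumes "Factorial_Ring.prime p" "T \<subseteq> Zp p" "T \<noteq> {}" "T \<noteq> Zp p"
  shows "\<exists>!s. s \<in> Zp p \<and> [int (card T) * s = \<Sum>T] (mod int p)"
proof -
  have p: "0 < p" using assms(1) by (rule prime_gt_0_nat)
  have "finite T" using assms(2) finite_Zp[OF p] finite_subset by blast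
  then have pos: "0 < card T" using assms(3) by (simp add: card_gt_0_iff)
  have less: "card T < p"
    using psubset_card_mono[of "Zp p" T] assms(2,4) finite_Zp[OF p] card_Zp[OF p] by auto
  have "\<not> p dvd card T" using pos less by (simp add: nat_dvd_not_less)
  then have "coprime p (card T)" using assms(1) by (simp add: prime_imp_coprime)
  then have cop: "coprime (int (card T)) (int p)" by (simp add: coprime_commute)
  then obtain x where x: "[int (card T) * x = 1] (mod int p)"
    using cong_solve_coprime_int by blast
  define s where "s = (x * \<Sum>T) mod int p"
  have "[int (card T) * s = int (card T) * (x * \<Sum>T)] (mod int p)"
    unfolding s_def by (simp add: cong_def mod_mult_right_eq)
  also have "[int (card T) * (x * \<Sum>T) = 1 * \<Sum>T] (mod int p)"
    using cong_scalar_right[OF x, of "\<Sum>T"] by (simp add: mult.assoc)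
  finally have s: "[int (card T) * s = \<Sum>T] (mod int p)" by simp
  show ?thesis
  proof (rule ex1I[of _ s])
    show "s \<in> Zp p \<and> [int (card T) * s = \<Sum>T] (mod int p)"
      using s p by (simp add: s_def Zp_eq)
  next
    fix t assume t: "t \<in> Zp p \<and> [int (card T) * t = \<Sum>T] (mod int p)"
    then have "[int (card T) * t = int (card T) * s] (mod int p)"
      using s by (meson cong_sym cong_trans)
    then have "[t = s] (mod int p)" using cop by (simp add: cong_mult_lcancel)
    then show "t = s"
      using t p by (intro cong_less_imp_eq_int[of t "int p" s]) (auto simp: Zp_eq s_def)
  qed
qed

lemma barycentre_shift:
  assumes "Factorial_Ring.prime p" "T \<subseteq> Zp p" "T \<noteq> {}" "T \<noteq> Zp p"
  shows "barycentre p ((\<lambda>j. (j + \<epsilon>) mod int p) ` T) = (barycentre p T + \<epsilon>) mod int p"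
proof -
  let ?f = "\<lambda>j. (j + \<epsilon>) mod int p"
  have p: "0 < p" using assms(1) by (rule prime_gt_0_nat)
  have inj: "inj_on ?f T"
    using bij_betw_shift[OF p, of \<epsilon>] assms(2) by (meson bij_betw_imp_inj_on inj_on_subset)
  have card: "card (?f ` T) = card T" using inj by (rule card_image)
  have sub: "?f ` T \<subseteq> Zp p" using p by (auto simp: Zp_eq)
  have "card T \<noteq> card (Zp p)"
    using assms(2,4) finite_Zp[OF p] by (metis card_subset_eq)
  then have ne: "?f ` T \<noteq> Zp p" using card by metis
  have b: "barycentre p T \<in> Zp p" "[int (card T) * barycentre p T = \<Sum>T] (mod int p)"
    using theI'[OF ex1_barycentre[OF assms]] unfolding barycentre_def by auto
  have "[int (card T) * ((barycentre p T + \<epsilon>) mod int p)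
        = int (card T) * barycentre p T + int (card T) * \<epsilon>] (mod int p)"
    by (simp add: cong_def mod_mult_right_eq distrib_left)
  also have "[int (card T) * barycentre p T + int (card T) * \<epsilon> = \<Sum>T + int (card T) * \<epsilon>] (mod int p)"
    using b(2) by (intro cong_add cong_refl)
  also have "\<Sum>T + int (card T) * \<epsilon> = (\<Sum>j\<in>T. j + \<epsilon>)" by (simp add: sum.distrib)
  also have "[(\<Sum>j\<in>T. j + \<epsilon>) = \<Sum>(?f ` T)] (mod int p)"
    using inj by (simp add: sum.reindex cong_def mod_sum_eq)
  finally have c: "[int (card (?f ` T)) * ((barycentre p T + \<epsilon>) mod int p) = \<Sum>(?f ` T)] (mod int p)"
    using card by simp
  have "(barycentre p T + \<epsilon>) mod int p \<in> Zp p" using p by (simp add: Zp_eq)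
  then show ?thesis unfolding barycentre_def[of p "?f ` T"]
    using the1_equality[OF ex1_barycentre[OF assms(1) sub _ ne]] c assms(3) by blast
qed

text \<open>The chosen value depends only on the image of \<open>F\<close>, which a rotation of \<open>F\<close> does not change;
  hence the fibre rotates with \<open>F\<close>.\<close>

definition chosen_fibre :: "nat \<Rightarrow> (int \<Rightarrow> 'a) \<Rightarrow> int set" where
  "chosen_fibre p F = {j \<in> Zp p. F j = (SOME x. x \<in> F ` Zp p)}"

lemma chosen_fibre_proper:
  assumes "0 < p" "\<not> F constant_on Zp p"
  shows "chosen_fibre p F \<subseteq> Zp p" "chosen_fibre p F \<noteq> {}" "chosen_fibre p F \<noteq> Zp p"
proof -
  have "Zp p \<noteq> {}" using assms(1) by (auto simp: Zp_eq)
  then have "(SOME x. x \<in> F ` Zp p) \<in> F ` Zp p" by (intro some_in_eq[THEN iffD2]) auto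
  then show "chosen_fibre p F \<noteq> {}" by (auto simp: chosen_fibre_def)
  show "chosen_fibre p F \<noteq> Zp p"
    using assms(2) by (auto simp: chosen_fibre_def constant_on_def)
qed (auto simp: chosen_fibre_def)

lemma chosen_fibre_shift:
  assumes "0 < p" and FG: "\<forall>j\<in>Zp p. G ((j + \<epsilon>) mod int p) = F j"
  shows "chosen_fibre p G = (\<lambda>j. (j + \<epsilon>) mod int p) ` chosen_fibre p F"
proof -
  let ?f = "\<lambda>j. (j + \<epsilon>) mod int p"
  have f: "?f ` Zp p = Zp p" using bij_betw_shift[OF assms(1)] by (rule bij_betw_imp_surj_on)
  have "G ` Zp p = G ` ?f ` Zp p" by (simp only: f)
  also have "\<dots> = F ` Zp p" unfolding image_image using FG by (intro image_cong) auto
  finally have im: "G ` Zp p = F ` Zp p" .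
  have "chosen_fibre p G = {k \<in> ?f ` Zp p. G k = (SOME x. x \<in> F ` Zp p)}"
    unfolding chosen_fibre_def by (simp only: f im)
  also have "\<dots> = ?f ` chosen_fibre p F"
    unfolding chosen_fibre_def using FG by auto
  finally show ?thesis .
qed

section \<open>Level and orientation of a tuple of sets\<close>

definition min_size :: "nat \<Rightarrow> (int \<Rightarrow> 'a set) \<Rightarrow> nat" where
  "min_size p A = Min ((\<lambda>j. card (A j)) ` Zp p)"

text \<open>The largest total size of a balanced tuple of subsets: no part may exceed the smallest
  one by more than one.\<close>

definition level :: "nat \<Rightarrow> (int \<Rightarrow> 'a set) \<Rightarrow> nat" where
  "level p A = (\<Sum>j\<in>Zp p. min (card (A j)) (Suc (min_size p A)))"

text \<open>What remains of a tuple when all parts that are not of minimal size are made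
  indistinguishable. Along a chain of tuples of constant level only those parts can grow.\<close>

definition profile :: "nat \<Rightarrow> (int \<Rightarrow> 'a set) \<Rightarrow> int \<Rightarrow> 'a set option" where
  "profile p A j = (if card (A j) = min_size p A then Some (A j) else None)"

definition orientation :: "nat \<Rightarrow> (int \<Rightarrow> 'a set) \<Rightarrow> int" where
  "orientation p A = barycentre p (chosen_fibre p (profile p A))"

lemma min_size_le:
  assumes "0 < p" "j \<in> Zp p" shows "min_size p A \<le> card (A j)"
  unfolding min_size_def using assms finite_Zp by (intro Min_le) auto

lemma min_size_attained:
  assumes "0 < p" obtains j where "j \<in> Zp p" "card (A j) = min_size p A"
proof -
  have "Min ((\<lambda>j. card (A j)) ` Zp p) \<in> (\<lambda>j. card (A j)) ` Zp p"
    using assms finite_Zp by (intro Min_in) (auto simp: Zp_eq)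
  then show thesis using that unfolding min_size_def by auto
qed

lemma profile_nonconstant:
  assumes "0 < p" "\<not> A constant_on Zp p"
  shows "\<not> profile p A constant_on Zp p"
proof
  assume c: "profile p A constant_on Zp p"
  obtain i where i: "i \<in> Zp p" "card (A i) = min_size p A"
    using min_size_attained[OF assms(1)] by blast
  have "A j = A i" if "j \<in> Zp p" for j
  proof -
    have "profile p A j = profile p A i" using c that i(1) by (auto simp: constant_on_def)
    then show ?thesis using i(2) by (auto simp: profile_def split: if_splits)
  qed
  then show False using assms(2) by (auto simp: constant_on_def)
qed

lemma orientation_in_Zp:
  assumes "Factorial_Ring.prime p" "\<not> A constant_on Zp p"
  shows "orientation p A \<in> Zp p"
proof -
  have p: "0 < p" using assms(1) by (rule prime_gt_0_nat)
  note cf = chosen_fibre_proper[OF p profile_nonconstant[OF p assms(2)]]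
  show ?thesis unfolding orientation_def barycentre_def
    using theI'[OF ex1_barycentre[OF assms(1) cf]] by blast
qed

lemma level_ge: assumes "0 < p" shows "p * min_size p A \<le> level p A"
proof -
  have "p * min_size p A = (\<Sum>j\<in>Zp p. min_size p A)" using card_Zp[OF assms] by simp
  also have "\<dots> \<le> level p A" unfolding level_def
    using min_size_le[OF assms, of _ A] by (intro sum_mono) simp
  finally show ?thesis .
qed

lemma level_less: assumes "0 < p" shows "level p A < p * Suc (min_size p A)"
proof -
  obtain i where i: "i \<in> Zp p" "card (A i) = min_size p A"
    using min_size_attained[OF assms] by blast
  have "level p A < (\<Sum>j\<in>Zp p. Suc (min_size p A))" unfolding level_def
    by (intro sum_strict_mono_ex1 finite_Zp assms ballI bexI[OF _ i(1)]) (simp_all add: i(2))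
  then show ?thesis using card_Zp[OF assms] by simp
qed

lemma min_size_mono:
  assumes "0 < p" "\<forall>j\<in>Zp p. finite (B j)" "\<forall>j\<in>Zp p. A j \<subseteq> B j"
  shows "min_size p A \<le> min_size p B"
proof -
  obtain i where i: "i \<in> Zp p" "card (B i) = min_size p B"
    using min_size_attained[OF assms(1)] by blast
  have "min_size p A \<le> card (A i)" using assms(1) i(1) by (rule min_size_le)
  also have "\<dots> \<le> card (B i)" using assms(2,3) i(1) by (intro card_mono) auto
  finally show ?thesis using i(2) by simp
qed

lemma level_mono:
  assumes "0 < p" "\<forall>j\<in>Zp p. finite (B j)" "\<forall>j\<in>Zp p. A j \<subseteq> B j"
  shows "level p A \<le> level p B"
  unfolding level_def
proof (intro sum_mono)
  fix j assume j: "j \<in> Zp p"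
  have "card (A j) \<le> card (B j)" using assms(2,3) j by (intro card_mono) auto
  then show "min (card (A j)) (Suc (min_size p A)) \<le> min (card (B j)) (Suc (min_size p B))"
    using min_size_mono[OF assms] by auto
qed

text \<open>The bounds \<open>p m \<le> level < p (m + 1)\<close> show that the level determines the minimal size \<open>m\<close>,
  so equality of the two sums forces equality of their summands.\<close>

lemma profile_eq_if_level_eq:
  assumes "0 < p" "\<forall>j\<in>Zp p. finite (B j)" "\<forall>j\<in>Zp p. A j \<subseteq> B j"
    and eq: "level p A = level p B" and j: "j \<in> Zp p"
  shows "profile p A j = profile p B j"
proof -
  have "p * min_size p B < p * Suc (min_size p A)"
    using level_ge[OF assms(1), of B] level_less[OF assms(1), of A] eq by linarith
  then have "min_size p B < Suc (min_size p A)" by (simp only: mult_less_cancel1)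
  then have m: "min_size p A = min_size p B"
    using min_size_mono[OF assms(1-3)] by linarith
  have le: "card (A i) \<le> card (B i)" if "i \<in> Zp p" for i
    using assms(2,3) that by (intro card_mono) auto
  have "min (card (A j)) (Suc (min_size p A)) = min (card (B j)) (Suc (min_size p A))"
  proof (rule sum_mono_inv[OF _ _ j finite_Zp[OF assms(1)]])
    show "(\<Sum>j\<in>Zp p. min (card (A j)) (Suc (min_size p A)))
      = (\<Sum>j\<in>Zp p. min (card (B j)) (Suc (min_size p A)))"
      using eq m by (simp add: level_def)
  qed (use le in \<open>fastforce simp: min_def\<close>)
  then have c: "card (A j) = min_size p A \<longleftrightarrow> card (B j) = min_size p B"
    using m by (auto simp: min_def split: if_splits)
  show ?thesis
  proof (cases "card (A j) = min_size p A")
    case True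
    then have "card (A j) = card (B j)" using c m by simp
    moreover have "finite (B j)" "A j \<subseteq> B j" using assms(2,3) j by auto
    ultimately have "A j = B j" by (simp add: card_subset_eq)
    then show ?thesis using m by (simp add: profile_def)
  qed (use c in \<open>simp add: profile_def\<close>)
qed

lemma orientation_eq_if_level_eq:
  assumes "0 < p" "\<forall>j\<in>Zp p. finite (B j)" "\<forall>j\<in>Zp p. A j \<subseteq> B j"
    and eq: "level p A = level p B"
  shows "orientation p A = orientation p B"
proof -
  note pr = profile_eq_if_level_eq[OF assms]
  have "profile p A ` Zp p = profile p B ` Zp p" using pr by (intro image_cong) auto
  then show ?thesis using pr by (auto simp: orientation_def chosen_fibre_def cong: conj_cong)
qed

lemma min_size_shift:
  assumes "0 < p" and AB: "\<forall>j\<in>Zp p. B ((j + \<epsilon>) mod int p) = A j"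
  shows "min_size p B = min_size p A"
proof -
  let ?f = "\<lambda>j. (j + \<epsilon>) mod int p"
  have f: "?f ` Zp p = Zp p" using bij_betw_shift[OF assms(1)] by (rule bij_betw_imp_surj_on)
  have "(\<lambda>j. card (B j)) ` Zp p = (\<lambda>j. card (B j)) ` ?f ` Zp p" by (simp only: f)
  also have "\<dots> = (\<lambda>j. card (A j)) ` Zp p"
    unfolding image_image using AB by (intro image_cong) auto
  finally show ?thesis by (simp add: min_size_def)
qed

lemma level_shift:
  assumes "0 < p" and AB: "\<forall>j\<in>Zp p. B ((j + \<epsilon>) mod int p) = A j"
  shows "level p B = level p A"
  unfolding level_def min_size_shift[of p B \<epsilon> A, OF assms]
  by (rule sum.reindex_bij_betw[OF bij_betw_shift[OF assms(1), of \<epsilon>], symmetric, THEN trans])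
     (use AB in \<open>auto intro!: sum.cong\<close>)

lemma orientation_shift:
  assumes "Factorial_Ring.prime p" "\<not> A constant_on Zp p"
    and AB: "\<forall>j\<in>Zp p. B ((j + \<epsilon>) mod int p) = A j"
  shows "orientation p B = (orientation p A + \<epsilon>) mod int p"
proof -
  have p: "0 < p" using assms(1) by (rule prime_gt_0_nat)
  have "chosen_fibre p (profile p B)
    = (\<lambda>j. (j + \<epsilon>) mod int p) ` chosen_fibre p (profile p A)"
    using AB by (intro chosen_fibre_shift p) (simp add: profile_def min_size_shift[of p B \<epsilon> A, OF p AB])
  then show ?thesis unfolding orientation_def
    using barycentre_shift[OF assms(1) chosen_fibre_proper[OF p profile_nonconstant[OF p assms(2)]]]
    by simp
qed

text \<open>Writing \<open>N = p q + s\<close> with \<open>s < p\<close>, all parts get \<open>q\<close> elements and \<open>s\<close> of them one more. Enough parts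
  have more than \<open>q\<close> elements: all of them if \<open>q\<close> is below the minimal size, and exactly
  \<open>level p A - p q\<close> if it equals the minimal size.\<close>

lemma balanced_sizes:
  assumes "0 < p" "N \<le> level p A"
  shows "\<exists>b. (\<forall>j\<in>Zp p. b j \<le> card (A j)) \<and> (\<Sum>j\<in>Zp p. b j) = N \<and>
    (\<forall>i j. \<bar>int (b i) - int (b j)\<bar> \<le> 1)"
proof -
  define m where "m = min_size p A"
  define q where "q = N div p"
  define S where "S = {j \<in> Zp p. q < card (A j)}"
  have "N < p * Suc m" using assms level_less[OF assms(1), of A] unfolding m_def by linarith
  then have qm: "q \<le> m" unfolding q_def
    using less_mult_imp_div_less[of N "Suc m" p] by (simp add: mult.commute)
  have N: "N = p * q + N mod p" by (simp add: q_def)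
  have fin: "finite (Zp p)" using assms(1) by (rule finite_Zp)
  have ge: "m \<le> card (A j)" if "j \<in> Zp p" for j
    using min_size_le[OF assms(1) that] by (simp add: m_def)
  have "N mod p \<le> card S"
  proof (cases "q < m")
    case True
    then have "S = Zp p" using ge by (fastforce simp: S_def)
    then show ?thesis using card_Zp[OF assms(1)] assms(1) by (simp add: less_imp_le)
  next
    case False
    then have q: "q = m" using qm by simp
    have "level p A = (\<Sum>j\<in>Zp p. m + (if j \<in> S then 1 else 0))"
      unfolding level_def m_def[symmetric]
      using ge q by (intro sum.cong) (fastforce simp: S_def min_def)+
    also have "\<dots> = p * m + card S"
      using fin card_Zp[OF assms(1)]
      by (simp add: sum.distrib sum.If_cases S_def Int_def conj_ac)
    finally show ?thesis using assms(2) N q by simp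
  qed
  then obtain T where T: "T \<subseteq> S" "card T = N mod p" by (rule obtain_subset_with_card_n)
  have TZ: "Zp p \<inter> T = T" using T(1) by (auto simp: S_def)
  show ?thesis
  proof (intro exI[of _ "\<lambda>j. q + (if j \<in> T then 1 else 0)"] conjI ballI allI)
    show "q + (if j \<in> T then 1 else 0) \<le> card (A j)" if "j \<in> Zp p" for j
      using T(1) ge[OF that] qm by (auto simp: S_def)
    show "(\<Sum>j\<in>Zp p. q + (if j \<in> T then 1 else 0)) = N"
      using fin card_Zp[OF assms(1)] T(2) N TZ by (simp add: sum.distrib sum.If_cases)
  qed simp
qed

section \<open>Complete partite families and colours\<close>

definition complete_family :: "nat \<Rightarrow> 'v hypergraph \<Rightarrow> 'i set \<Rightarrow> ('i \<Rightarrow> 'v set) \<Rightarrow> bool" where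
  "complete_family r H I U \<longleftrightarrow> partite_family H I U \<and> complete_partite r H I U"

lemma complete_family_mono:
  assumes "complete_family r H I U" and VU: "\<And>i. i \<in> I \<Longrightarrow> V i \<subseteq> U i"
  shows "complete_family r H I V"
proof -
  have part: "\<And>i. i \<in> I \<Longrightarrow> U i \<subseteq> verts H" "disjoint_family_on U I"
    using assms(1) by (auto simp: complete_family_def partite_family_def)
  have "partite_family H I V"
    unfolding partite_family_def disjoint_family_on_def
  proof (intro conjI ballI impI)
    fix i assume i: "i \<in> I"
    show "V i \<subseteq> verts H" using part(1)[OF i] VU[OF i] by blast
    fix k assume k: "k \<in> I" "i \<noteq> k"
    then have "U i \<inter> U k = {}" using part(2) i by (simp add: disjoint_family_on_def)
    then show "V i \<inter> V k = {}" using VU[OF i] VU[OF k(1)] by blast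
  qed
  moreover have "complete_partite r H I V" unfolding complete_partite_def
  proof (intro allI impI)
    fix e assume e: "e \<subseteq> (\<Union>i\<in>I. V i) \<and> card e = r \<and> (\<forall>i\<in>I. card (e \<inter> V i) \<le> 1)"
    have "e \<inter> U i = e \<inter> V i" if "i \<in> I" for i
    proof
      show "e \<inter> U i \<subseteq> e \<inter> V i"
      proof
        fix v assume v: "v \<in> e \<inter> U i"
        then obtain k where k: "k \<in> I" "v \<in> V k" using e by blast
        then have "U k \<inter> U i \<noteq> {}" using VU[OF k(1)] v by blast
        then have "k = i" using part(2) k(1) that unfolding disjoint_family_on_def by blast
        then show "v \<in> e \<inter> V i" using v k by simp
      qed
    qed (use VU that in blast)
    moreover have "e \<subseteq> (\<Union>i\<in>I. U i)" using e VU by blast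
    ultimately have "e \<in> edges (partite_sub H I U)"
      using assms(1) e by (simp add: complete_family_def complete_partite_def)
    then show "e \<in> edges (partite_sub H I V)" using e by (simp add: partite_sub_def)
  qed
  ultimately show ?thesis by (simp add: complete_family_def)
qed

lemma complete_family_reindex:
  assumes "complete_family r H J U" "bij_betw g I J"
  shows "complete_family r H I (\<lambda>i. U (g i))"
proof -
  have gim: "g ` I = J" and ginj: "inj_on g I" using assms(2) by (auto simp: bij_betw_def)
  have gin: "g i \<in> J" if "i \<in> I" for i using gim that by blast
  have un: "(\<Union>i\<in>I. U (g i)) = (\<Union>j\<in>J. U j)" unfolding gim[symmetric] by simp
  have all: "(\<forall>i\<in>I. P (g i)) = (\<forall>j\<in>J. P j)" for P unfolding gim[symmetric] by simp
  have "U (g i) \<inter> U (g k) = {}" if "i \<in> I" "k \<in> I" "i \<noteq> k" for i k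
  proof -
    have "g i \<noteq> g k" using that ginj by (simp add: inj_on_eq_iff)
    then show ?thesis using assms(1) gin that(1,2)
      by (simp add: complete_family_def partite_family_def disjoint_family_on_def)
  qed
  moreover have "\<forall>i\<in>I. U (g i) \<subseteq> verts H"
    using assms(1) gin by (simp add: complete_family_def partite_family_def)
  ultimately have "partite_family H I (\<lambda>i. U (g i))"
    by (simp add: partite_family_def disjoint_family_on_def)
  moreover have "complete_partite r H I (\<lambda>i. U (g i))"
    unfolding complete_partite_def
  proof (intro allI impI)
    fix e
    assume "e \<subseteq> (\<Union>i\<in>I. U (g i)) \<and> card e = r \<and> (\<forall>i\<in>I. card (e \<inter> U (g i)) \<le> 1)"
    then have e: "e \<subseteq> (\<Union>j\<in>J. U j)" "card e = r" "\<forall>i\<in>I. card (e \<inter> U (g i)) \<le> 1"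
      unfolding un by blast+
    have "\<forall>j\<in>J. card (e \<inter> U j) \<le> 1"
      using e(3) all[of "\<lambda>j. card (e \<inter> U j) \<le> 1"] by (rule rev_iffD1)
    then have "e \<in> edges (partite_sub H J U)"
      using assms(1) e(1,2) by (simp add: complete_family_def complete_partite_def)
    then have "e \<in> edges H" by (simp add: partite_sub_def)
    then show "e \<in> edges (partite_sub H I (\<lambda>i. U (g i)))"
      using e(1,3) unfolding partite_sub_def un by simp
  qed
  ultimately show ?thesis by (simp add: complete_family_def)
qed

text \<open>One vertex of the same colour from each of \<open>r\<close> parts would form a monochromatic edge.\<close>

lemma colour_in_few_parts:
  assumes "complete_family r H I U" "proper_coloring H c"
  shows "card {i \<in> I. a \<in> c ` U i} < r"
proof (rule ccontr)
  assume "\<not> ?thesis"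
  then have "r \<le> card {i \<in> I. a \<in> c ` U i}" by simp
  then obtain J where J: "J \<subseteq> {i \<in> I. a \<in> c ` U i}" "card J = r"
    by (rule obtain_subset_with_card_n)
  have disj: "disjoint_family_on U I"
    using assms(1) by (simp add: complete_family_def partite_family_def)
  have "\<forall>i\<in>J. \<exists>v. v \<in> U i \<and> c v = a" using J(1) by auto
  from bchoice[OF this] obtain v where v: "\<And>i. i \<in> J \<Longrightarrow> v i \<in> U i" "\<And>i. i \<in> J \<Longrightarrow> c (v i) = a"
    by blast
  have eq: "i = k" if "k \<in> J" "i \<in> I" "v k \<in> U i" for i k
    using disj v(1)[OF that(1)] that J(1) by (auto simp: disjoint_family_on_def)
  have "inj_on v J"
  proof (rule inj_onI)
    fix i k assume "i \<in> J" "k \<in> J" "v i = v k"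
    then show "i = k" using eq[of k i] v(1)[of i] J(1) by auto
  qed
  then have "card (v ` J) = r" using J(2) by (simp add: card_image)
  moreover have "card (v ` J \<inter> U i) \<le> 1" if "i \<in> I" for i
  proof -
    have "v ` J \<inter> U i \<subseteq> {v i}" using eq that by blast
    then show ?thesis using card_mono[of "{v i}"] by simp
  qed
  moreover have "v ` J \<subseteq> (\<Union>i\<in>I. U i)" using v(1) J(1) by blast
  ultimately have "v ` J \<in> edges (partite_sub H I U)"
    using assms(1) by (simp add: complete_family_def complete_partite_def)
  then have "v ` J \<in> edges H" by (simp add: partite_sub_def)
  then show False using assms(2) v(2) by (auto simp: proper_coloring_def)
qed

text \<open>Otherwise a colour would occur in all \<open>p \<ge> r\<close> parts.\<close>

lemma colours_nonconstant:
  assumes "complete_family r H (Zp p) U" "proper_coloring H c" "0 < p" "r \<le> p"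
    and ne: "(\<Union>j\<in>Zp p. U j) \<noteq> {}"
  shows "\<not> (\<lambda>j. c ` U j) constant_on Zp p"
proof
  assume "(\<lambda>j. c ` U j) constant_on Zp p"
  then obtain B where B: "\<And>j. j \<in> Zp p \<Longrightarrow> c ` U j = B" by (auto simp: constant_on_def)
  obtain i v where "i \<in> Zp p" "v \<in> U i" using ne by blast
  then have "c v \<in> B" using B by blast
  then have "{j \<in> Zp p. c v \<in> c ` U j} = Zp p" using B by blast
  then show False
    using colour_in_few_parts[OF assms(1,2), of "c v"] card_Zp[OF assms(3)] assms(4) by simp
qed

lemma finite_part:
  assumes "hypergraph H" "complete_family r H I U" "i \<in> I"
  shows "finite (U i)"
  using assms by (auto simp: hypergraph_def complete_family_def partite_family_def intro: finite_subset)

text \<open>Pick one vertex for each colour in a balanced choice of colour sets.\<close>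

lemma colourful_subfamily:
  assumes "complete_family r H (Zp p) U" "0 < p" "N \<le> level p (\<lambda>j. c ` U j)"
  shows "has_colorful_balanced_complete_partite r H c p (int N)"
proof -
  obtain b where b: "\<forall>j\<in>Zp p. b j \<le> card (c ` U j)" "(\<Sum>j\<in>Zp p. b j) = N"
    "\<forall>i j. \<bar>int (b i) - int (b j)\<bar> \<le> 1"
    using balanced_sizes[OF assms(2,3)] by auto
  have "\<exists>W. W \<subseteq> U j \<and> inj_on c W \<and> card W = b j" if j: "j \<in> Zp p" for j
  proof -
    obtain T where T: "T \<subseteq> c ` U j" "card T = b j"
      using bspec[OF b(1) j] by (rule obtain_subset_with_card_n)
    obtain W where W: "W \<subseteq> U j" "inj_on c W" "T = c ` W"
      using T(1) unfolding subset_image_inj by auto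
    then have "card W = b j" using T(2) card_image[OF W(2)] by simp
    then show ?thesis using W by blast
  qed
  then have "\<forall>j\<in>Zp p. \<exists>W. W \<subseteq> U j \<and> inj_on c W \<and> card W = b j" by blast
  then obtain V where
    VZ: "\<forall>j\<in>Zp p. V j \<subseteq> U j \<and> inj_on c (V j) \<and> card (V j) = b j"
    by (rule bchoice[THEN exE])
  then have V: "V j \<subseteq> U j" "inj_on c (V j)" "card (V j) = b j" if "j \<in> Zp p" for j
    using that by simp_all
  have cV: "complete_family r H (Zp p) V" using assms(1) V(1) by (rule complete_family_mono)
  \<comment> \<open>The parts are renamed from residues to \<open>{1..p}\<close>.\<close>
  define g where "g = (\<lambda>i::nat. int i - 1)"
  have g: "bij_betw g {1..p} (Zp p)"
    by (rule bij_betw_byWitness[where f' = "\<lambda>j. nat (j + 1)"])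
       (use assms(2) in \<open>auto simp: g_def Zp_eq\<close>)
  have gim: "g ` {1..p} = Zp p" using g by (rule bij_betw_imp_surj_on)
  have gin: "g i \<in> Zp p" if "i \<in> {1..p}" for i using gim that by blast
  have "complete_family r H {1..p} (\<lambda>i. V (g i))" using cV g by (rule complete_family_reindex)
  moreover have "balanced {1..p} (\<lambda>i. V (g i))"
    using V(3) b(3) gin by (auto simp: balanced_def)
  moreover have "colorful c {1..p} (\<lambda>i. V (g i))" using V(2) gin by (auto simp: colorful_def)
  moreover have "(\<Sum>i=1..p. card (V (g i))) = N"
    using sum.reindex_bij_betw[OF g, of "\<lambda>j. card (V j)"] V(3) b(2) by simp
  ultimately show ?thesis
    unfolding has_colorful_balanced_complete_partite_def complete_family_def by blast
qed

text \<open>Count pairs of a colour and a part containing it.\<close>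

lemma colourful_vertices_le:
  assumes "has_colorful_balanced_complete_partite r H c p N"
    and "proper_coloring H c" "c \<in> verts H \<rightarrow> {1..k}"
  shows "N \<le> int (k * (r - 1))"
proof -
  obtain U where U: "complete_family r H {1..p} U" "colorful c {1..p} U"
    "int (\<Sum>i=1..p. card (U i)) = N"
    using assms(1) by (auto simp: has_colorful_balanced_complete_partite_def complete_family_def)
  have sub: "c ` U i \<subseteq> {1..k}" if "i \<in> {1..p}" for i
    using U(1) assms(3) that by (fastforce simp: complete_family_def partite_family_def)
  have "(\<Sum>i=1..p. card (U i)) = (\<Sum>i=1..p. card (c ` U i))"
    using U(2) by (intro sum.cong) (auto simp: colorful_def card_image)
  also have "\<dots> = (\<Sum>i=1..p. \<Sum>a=1..k. if a \<in> c ` U i then 1 else 0)"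
    using sub by (intro sum.cong refl) (simp add: sum.If_cases Int_absorb1)
  also have "\<dots> = (\<Sum>a=1..k. \<Sum>i=1..p. if a \<in> c ` U i then 1 else 0)" by (rule sum.swap)
  also have "\<dots> = (\<Sum>a=1..k. card {i \<in> {1..p}. a \<in> c ` U i})"
    by (intro sum.cong refl) (simp add: sum.If_cases Int_def)
  also have "\<dots> \<le> (\<Sum>a=1..k. r - 1)"
  proof (rule sum_mono)
    fix a
    show "card {i \<in> {1..p}. a \<in> c ` U i} \<le> r - 1"
      using colour_in_few_parts[OF U(1) assms(2), of a] by linarith
  qed
  finally have "(\<Sum>i=1..p. card (U i)) \<le> k * (r - 1)" by simp
  then show ?thesis unfolding U(3)[symmetric] by (simp only: of_nat_le_iff)
qed

lemma chromatic_number_attained: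
  assumes "c \<in> verts H \<rightarrow> {1..C}" "proper_coloring H c"
  obtains c' where "c' \<in> verts H \<rightarrow> {1..chromatic_number H}" "proper_coloring H c'"
proof -
  have "\<exists>c \<in> verts H \<rightarrow> {1..chromatic_number H}. proper_coloring H c"
    unfolding chromatic_number_def using assms
    by (intro LeastI_ex[of "\<lambda>k. \<exists>c \<in> verts H \<rightarrow> {1..k}. proper_coloring H c"]) blast
  then show thesis using that by blast
qed

section \<open>From maps of face posets to maps of realizations\<close>

text \<open>A stand-in for the coordinate of the point \<open>x\<close> at the barycentre of \<open>\<sigma>\<close> in the barycentric
  subdivision: it is positive exactly if every coordinate of \<open>x\<close> on \<open>\<sigma>\<close> exceeds every coordinate
  on the remaining vertices of \<open>V\<close>, so the sets of positive weight form a flag. As a product of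
  positive parts it is visibly continuous and invariant under bijections.\<close>

definition flag_weight :: "'a set \<Rightarrow> 'a set \<Rightarrow> ('a \<Rightarrow> real) \<Rightarrow> real" where
  "flag_weight V \<sigma> x = (\<Prod>v\<in>\<sigma>. \<Prod>u\<in>V - \<sigma>. max 0 (x v - x u))"

lemma flag_weight_nonneg: "0 \<le> flag_weight V \<sigma> x"
  by (simp add: flag_weight_def prod_nonneg)

lemma flag_weight_pos_iff:
  assumes "finite V" "\<sigma> \<subseteq> V"
  shows "flag_weight V \<sigma> x \<noteq> 0 \<longleftrightarrow> (\<forall>v\<in>\<sigma>. \<forall>u\<in>V - \<sigma>. x u < x v)"
proof -
  have "finite \<sigma>" using assms finite_subset by blast
  moreover have "max 0 (x v - x u) = 0 \<longleftrightarrow> \<not> x u < x v" for u v by (auto simp: max_def)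
  ultimately show ?thesis using assms(1) by (simp add: flag_weight_def)
qed

lemma flag_weight_chain:
  assumes "finite V" "\<sigma> \<subseteq> V" "\<tau> \<subseteq> V" "flag_weight V \<sigma> x \<noteq> 0" "flag_weight V \<tau> x \<noteq> 0"
  shows "\<sigma> \<subseteq> \<tau> \<or> \<tau> \<subseteq> \<sigma>"
proof (rule ccontr)
  assume "\<not> ?thesis"
  then obtain v u where vu: "v \<in> \<sigma>" "v \<notin> \<tau>" "u \<in> \<tau>" "u \<notin> \<sigma>" by blast
  have "x u < x v"
    using assms(3,4) vu unfolding flag_weight_pos_iff[OF assms(1,2)] by blast
  moreover have "x v < x u"
    using assms(2,5) vu unfolding flag_weight_pos_iff[OF assms(1,3)] by blast
  ultimately show False by simp
qed

lemma continuous_flag_weight: "continuous_on S (flag_weight V \<sigma>)"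
proof -
  have "continuous_on S (\<lambda>x :: 'a \<Rightarrow> real. x v)" for v
    by (rule continuous_on_subset[OF continuous_on_product_coordinates]) simp
  then show ?thesis unfolding flag_weight_def
    by (intro continuous_intros) auto
qed

lemma flag_weight_reindex:
  assumes "bij_betw g V V" "\<sigma> \<subseteq> V" and xy: "\<forall>v\<in>V. y (g v) = x v"
  shows "flag_weight V (g ` \<sigma>) y = flag_weight V \<sigma> x"
proof -
  have inj: "inj_on g V" and im: "g ` V = V" using assms(1) by (auto simp: bij_betw_def)
  have "V - g ` \<sigma> = g ` (V - \<sigma>)" using inj_on_image_set_diff[OF inj, of V \<sigma>] im assms(2) by auto
  moreover have "inj_on g \<sigma>" "inj_on g (V - \<sigma>)" using inj assms(2) by (auto intro: inj_on_subset)
  ultimately have "flag_weight V (g ` \<sigma>) y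
    = (\<Prod>v\<in>\<sigma>. \<Prod>u\<in>V - \<sigma>. max 0 (y (g v) - y (g u)))"
    by (simp add: flag_weight_def prod.reindex)
  also have "\<dots> = flag_weight V \<sigma> x"
    unfolding flag_weight_def using xy assms(2) by (intro prod.cong refl) (auto simp: subset_iff)
  finally show ?thesis .
qed

text \<open>The vertices at which \<open>x\<close> is maximal form a face of the support of \<open>x\<close>.\<close>

lemma sum_flag_weight_pos:
  assumes fin: "finite K" "finite (\<Union>K)"
    and down: "\<forall>\<sigma>\<in>K. \<forall>\<tau>. \<tau> \<subseteq> \<sigma> \<longrightarrow> \<tau> \<noteq> {} \<longrightarrow> \<tau> \<in> K"
    and x: "\<forall>v. 0 \<le> x v" "{v. x v \<noteq> 0} \<in> K" "{v. x v \<noteq> 0} \<noteq> {}"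
  shows "0 < (\<Sum>\<sigma>\<in>K. flag_weight (\<Union>K) \<sigma> x)"
proof -
  let ?S = "{v. x v \<noteq> 0}"
  have finS: "finite ?S" using x(2) fin(2) by (meson Sup_upper finite_subset)
  define M where "M = Max (x ` ?S)"
  define \<sigma> where "\<sigma> = {v \<in> ?S. x v = M}"
  have "M \<in> x ` ?S" unfolding M_def using finS x(3) by (intro Max_in) auto
  then obtain w where w: "x w \<noteq> 0" "x w = M" by auto
  then have Mpos: "0 < M" using x(1) by (metis less_eq_real_def)
  have le: "x v \<le> M" for v
  proof (cases "x v = 0")
    case False
    then show ?thesis unfolding M_def using finS by (intro Max_ge) auto
  qed (use Mpos in simp)
  have "\<sigma> \<subseteq> ?S" "\<sigma> \<noteq> {}" using w unfolding \<sigma>_def by auto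
  then have sK: "\<sigma> \<in> K" using down x(2) by blast
  have "x u < x v" if "v \<in> \<sigma>" "u \<notin> \<sigma>" for u v
    using that le[of u] Mpos unfolding \<sigma>_def by (cases "x u = 0") auto
  then have "flag_weight (\<Union>K) \<sigma> x \<noteq> 0"
    using flag_weight_pos_iff[OF fin(2), of \<sigma> x] sK by blast
  then have "0 < flag_weight (\<Union>K) \<sigma> x"
    using flag_weight_nonneg[of "\<Union>K" \<sigma> x] by (simp add: less_le)
  then show ?thesis using fin(1) sK by (intro sum_pos2) (auto simp: flag_weight_nonneg)
qed

text \<open>It replaces the affine map on the barycentric subdivision of \<open>K\<close> induced by \<open>f\<close>: the
  normalized weight of each simplex \<open>\<sigma>\<close> goes to the vertex \<open>f \<sigma>\<close>.\<close>

definition subdivision_map :: "'a set set \<Rightarrow> ('a set \<Rightarrow> 'b) \<Rightarrow> ('a \<Rightarrow> real) \<Rightarrow> ('b \<Rightarrow> real)" where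
  "subdivision_map K f x = (\<lambda>w. (\<Sum>\<sigma>\<in>{\<sigma> \<in> K. f \<sigma> = w}. flag_weight (\<Union>K) \<sigma> x)
                                / (\<Sum>\<sigma>\<in>K. flag_weight (\<Union>K) \<sigma> x))"

text \<open>Simplices of positive weight at a common point form a chain, so their images under a map
  that preserves the order of faces are comparable, hence lie in different layers or coincide.\<close>

lemma subdivision_map_in_E_complex:
  assumes fin: "finite K" "finite (\<Union>K)"
    and down: "\<forall>\<sigma>\<in>K. \<forall>\<tau>. \<tau> \<subseteq> \<sigma> \<longrightarrow> \<tau> \<noteq> {} \<longrightarrow> \<tau> \<in> K"
    and f: "f \<in> K \<rightarrow> Q_poset p n" "monotone_on K (\<subseteq>) Q_le f"
    and x: "\<forall>v. 0 \<le> x v" "{v. x v \<noteq> 0} \<in> K" "{v. x v \<noteq> 0} \<noteq> {}"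
  shows "(\<forall>w. 0 \<le> subdivision_map K f x w)
    \<and> {w. subdivision_map K f x w \<noteq> 0} \<in> E_complex p n
    \<and> (\<Sum>w | subdivision_map K f x w \<noteq> 0. subdivision_map K f x w) = 1"
proof -
  let ?g = "subdivision_map K f x" and ?\<mu> = "\<lambda>\<sigma>. flag_weight (\<Union>K) \<sigma> x"
  let ?T = "{w. ?g w \<noteq> 0}"
  have pos: "0 < (\<Sum>\<sigma>\<in>K. ?\<mu> \<sigma>)" using sum_flag_weight_pos[OF fin down x] .
  have nonneg: "0 \<le> ?g w" for w
    unfolding subdivision_map_def by (intro divide_nonneg_nonneg sum_nonneg flag_weight_nonneg)
  have supp: "\<exists>\<sigma>\<in>K. f \<sigma> = w \<and> ?\<mu> \<sigma> \<noteq> 0" if "?g w \<noteq> 0" for w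
  proof (rule ccontr)
    assume "\<not> ?thesis"
    then have "(\<Sum>\<sigma>\<in>{\<sigma> \<in> K. f \<sigma> = w}. ?\<mu> \<sigma>) = 0" by (intro sum.neutral) auto
    then show False using that by (simp add: subdivision_map_def)
  qed
  have T: "?T \<subseteq> f ` K" using supp by blast
  have "(\<Sum>w | ?g w \<noteq> 0. ?g w) = (\<Sum>w\<in>f ` K. ?g w)"
    using fin(1) T by (intro sum.mono_neutral_left) auto
  also have "\<dots> = (\<Sum>w\<in>f ` K. \<Sum>\<sigma>\<in>{\<sigma> \<in> K. f \<sigma> = w}. ?\<mu> \<sigma>) / (\<Sum>\<sigma>\<in>K. ?\<mu> \<sigma>)"
    by (simp add: subdivision_map_def sum_divide_distrib)
  also have "\<dots> = 1" using sum.group[OF fin(1) finite_imageI[OF fin(1)] subset_refl, of ?\<mu> f] pos by simp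
  finally have one: "(\<Sum>w | ?g w \<noteq> 0. ?g w) = 1" .
  have "?T \<noteq> {}"
  proof
    assume T0: "?T = {}"
    show False using one unfolding T0 by simp
  qed
  moreover have "?T \<subseteq> Zp p \<times> {1..n+1}" using T f(1) unfolding Q_poset_def by blast
  moreover have "inj_on snd ?T"
  proof (rule inj_onI)
    fix a b assume a: "a \<in> ?T" and b: "b \<in> ?T" and ab: "snd a = snd b"
    obtain \<sigma> where \<sigma>: "\<sigma> \<in> K" "f \<sigma> = a" "?\<mu> \<sigma> \<noteq> 0" using supp a by blast
    obtain \<tau> where \<tau>: "\<tau> \<in> K" "f \<tau> = b" "?\<mu> \<tau> \<noteq> 0" using supp b by blast
    have "\<sigma> \<subseteq> \<tau> \<or> \<tau> \<subseteq> \<sigma>"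
      using flag_weight_chain[OF fin(2) _ _ \<sigma>(3) \<tau>(3)] \<sigma>(1) \<tau>(1) by blast
    then have "Q_le a b \<or> Q_le b a"
      using f(2) \<sigma>(1,2) \<tau>(1,2) unfolding monotone_on_def by blast
    then show "a = b" using ab by (auto simp: Q_le_def)
  qed
  ultimately have "?T \<in> E_complex p n" by (simp add: E_complex_def)
  then show ?thesis using nonneg one by simp
qed

lemma subdivision_map_equivariant:
  assumes fin: "finite K" "finite (\<Union>K)"
    and inj: "inj_on g (\<Union>K)" and gK: "\<And>\<sigma>. \<sigma> \<in> K \<Longrightarrow> g ` \<sigma> \<in> K"
    and h: "\<And>\<sigma>. \<sigma> \<in> K \<Longrightarrow> f (g ` \<sigma>) = h (f \<sigma>)"
    and x: "{v. x v \<noteq> 0} \<in> K"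
  shows "subdivision_map K f (realization_map g x) = realization_map h (subdivision_map K f x)"
proof -
  let ?V = "\<Union>K" and ?y = "realization_map g x"
  have "g ` ?V \<subseteq> ?V" using gK by blast
  then have bij: "bij_betw g ?V ?V"
    using inj fin(2) by (simp add: bij_betw_def endo_inj_surj)
  have xV: "{v. x v \<noteq> 0} \<subseteq> ?V" using x by blast
  have y: "?y (g v) = x v" if v: "v \<in> ?V" for v
  proof -
    have eq: "{u. x u \<noteq> 0 \<and> g u = g v} = (if x v \<noteq> 0 then {v} else {})"
      using v xV inj by (auto dest: inj_onD)
    show ?thesis unfolding realization_map_def eq by simp
  qed
  have \<mu>: "flag_weight ?V (g ` \<sigma>) ?y = flag_weight ?V \<sigma> x" if "\<sigma> \<in> K" for \<sigma>
    using that y by (intro flag_weight_reindex[OF bij]) auto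
  have "inj_on ((`) g) K"
  proof (rule inj_onI)
    fix \<sigma> \<tau> assume "\<sigma> \<in> K" "\<tau> \<in> K" "g ` \<sigma> = g ` \<tau>"
    then show "\<sigma> = \<tau>" using inj_on_image_eq_iff[OF inj, of \<sigma> \<tau>] by blast
  qed
  moreover have "(`) g ` K \<subseteq> K" using gK by blast
  ultimately have bijK: "bij_betw ((`) g) K K"
    using fin(1) by (simp add: bij_betw_def endo_inj_surj)
  have S: "(\<Sum>\<sigma>\<in>K. flag_weight ?V \<sigma> ?y) = (\<Sum>\<sigma>\<in>K. flag_weight ?V \<sigma> x)"
    using sum.reindex_bij_betw[OF bijK, of "\<lambda>\<sigma>. flag_weight ?V \<sigma> ?y"] \<mu> by simp
  show ?thesis
  proof
    fix w
    let ?D = "\<Sum>\<sigma>\<in>K. flag_weight ?V \<sigma> x"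
    let ?s = "subdivision_map K f x"
    have "bij_betw ((`) g) {\<sigma> \<in> K. h (f \<sigma>) = w} {\<sigma> \<in> K. f \<sigma> = w}"
    proof (rule bij_betw_subset[OF bijK])
      show "(`) g ` {\<sigma> \<in> K. h (f \<sigma>) = w} = {\<sigma> \<in> K. f \<sigma> = w}"
      proof (intro equalityI subsetI)
        fix \<tau> assume \<tau>: "\<tau> \<in> {\<sigma> \<in> K. f \<sigma> = w}"
        then have "\<tau> \<in> (`) g ` K" using bijK by (simp add: bij_betw_def)
        then obtain \<sigma> where "\<sigma> \<in> K" "\<tau> = g ` \<sigma>" by blast
        then show "\<tau> \<in> (`) g ` {\<sigma> \<in> K. h (f \<sigma>) = w}" using \<tau> h by auto
      qed (use gK h in auto)
    qed auto
    then have "(\<Sum>\<sigma>\<in>{\<sigma> \<in> K. f \<sigma> = w}. flag_weight ?V \<sigma> ?y)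
      = (\<Sum>\<sigma>\<in>{\<sigma> \<in> K. h (f \<sigma>) = w}. flag_weight ?V (g ` \<sigma>) ?y)"
      by (rule sum.reindex_bij_betw[symmetric])
    also have "\<dots> = (\<Sum>\<sigma>\<in>{\<sigma> \<in> K. h (f \<sigma>) = w}. flag_weight ?V \<sigma> x)"
      using \<mu> by (intro sum.cong refl) auto
    also have "\<dots> = (\<Sum>a\<in>{a \<in> f ` K. h a = w}. \<Sum>\<sigma>\<in>{\<sigma> \<in> {\<sigma> \<in> K. h (f \<sigma>) = w}. f \<sigma> = a}.
        flag_weight ?V \<sigma> x)"
      using fin(1) by (intro sum.group[symmetric]) auto
    also have "\<dots> = (\<Sum>a\<in>{a \<in> f ` K. h a = w}. \<Sum>\<sigma>\<in>{\<sigma> \<in> K. f \<sigma> = a}. flag_weight ?V \<sigma> x)"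
      by (intro sum.cong refl) auto
    finally have num: "(\<Sum>\<sigma>\<in>{\<sigma> \<in> K. f \<sigma> = w}. flag_weight ?V \<sigma> ?y)
      = (\<Sum>a\<in>{a \<in> f ` K. h a = w}. \<Sum>\<sigma>\<in>{\<sigma> \<in> K. f \<sigma> = a}. flag_weight ?V \<sigma> x)" .
    have zero: "?s a = 0" if "a \<notin> f ` K" for a
    proof -
      have e: "{\<sigma> \<in> K. f \<sigma> = a} = {}" using that by blast
      show ?thesis unfolding subdivision_map_def e by simp
    qed
    have "subdivision_map K f ?y w = (\<Sum>a\<in>{a \<in> f ` K. h a = w}. ?s a)"
      unfolding subdivision_map_def S num by (rule sum_divide_distrib)
    also have "\<dots> = (\<Sum>a | ?s a \<noteq> 0 \<and> h a = w. ?s a)"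
      using zero fin(1) by (intro sum.mono_neutral_right) auto
    finally show "subdivision_map K f ?y w = realization_map h ?s w"
      by (simp add: realization_map_def)
  qed
qed

text \<open>In other words, the index of a complex is at most the cross-index of its face poset.\<close>

lemma equivariant_realization_map_exists:
  fixes K :: "'a set set"
  assumes fin: "finite K" "finite (\<Union>K)" and ne: "{} \<notin> K"
    and down: "\<forall>\<sigma>\<in>K. \<forall>\<tau>. \<tau> \<subseteq> \<sigma> \<longrightarrow> \<tau> \<noteq> {} \<longrightarrow> \<tau> \<in> K"
    and inj: "\<And>\<epsilon>. \<epsilon> \<in> Zp p \<Longrightarrow> inj_on (\<alpha> \<epsilon>) (\<Union>K)"
    and act: "\<And>\<epsilon> \<sigma>. \<epsilon> \<in> Zp p \<Longrightarrow> \<sigma> \<in> K \<Longrightarrow> \<alpha> \<epsilon> ` \<sigma> \<in> K"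
    and f: "f \<in> K \<rightarrow> Q_poset p n" "monotone_on K (\<subseteq>) Q_le f"
      "equivariant p K (\<lambda>\<epsilon>. (`) (\<alpha> \<epsilon>)) (left_act p) f"
  shows "\<exists>F. continuous_map (realization K) (realization (E_complex p n)) F \<and>
    equivariant p (topspace (realization K)) (\<lambda>\<epsilon>. realization_map (\<alpha> \<epsilon>))
      (\<lambda>\<epsilon>. realization_map (left_act p \<epsilon>)) F"
proof (intro exI[of _ "subdivision_map K f"] conjI)
  let ?X = "{x :: 'a \<Rightarrow> real. (\<forall>v. 0 \<le> x v) \<and> {v. x v \<noteq> 0} \<in> K \<and> (\<Sum>v | x v \<noteq> 0. x v) = 1}"
  have top: "topspace (realization K) = ?X" by (simp add: realization_def)
  have "continuous_on ?X (\<lambda>x. subdivision_map K f x w)" for w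
  proof -
    have "(\<Sum>\<sigma>\<in>K. flag_weight (\<Union>K) \<sigma> x) \<noteq> 0" if "x \<in> ?X" for x
    proof -
      have "{v. x v \<noteq> 0} \<noteq> {}" using that ne by force
      then show ?thesis using sum_flag_weight_pos[OF fin down, where x = x] that by simp
    qed
    then show ?thesis unfolding subdivision_map_def
      by (intro continuous_on_divide continuous_on_sum continuous_flag_weight) auto
  qed
  then have "continuous_on ?X (subdivision_map K f)"
    by (rule continuous_on_coordinatewise_then_product)
  moreover have "subdivision_map K f x \<in> {y. (\<forall>v. 0 \<le> y v) \<and> {v. y v \<noteq> 0} \<in> E_complex p n \<and>
      (\<Sum>v | y v \<noteq> 0. y v) = 1}" if "x \<in> ?X" for x
  proof -
    have "{v. x v \<noteq> 0} \<noteq> {}" using that ne by force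
    then show ?thesis using subdivision_map_in_E_complex[OF fin down f(1,2), where x = x] that by simp
  qed
  ultimately show "continuous_map (realization K) (realization (E_complex p n)) (subdivision_map K f)"
    unfolding realization_def continuous_map_in_subtopology continuous_map_iff_continuous
    by (auto simp: Pi_iff)
  show "equivariant p (topspace (realization K)) (\<lambda>\<epsilon>. realization_map (\<alpha> \<epsilon>))
      (\<lambda>\<epsilon>. realization_map (left_act p \<epsilon>)) (subdivision_map K f)"
    unfolding equivariant_def top
  proof (intro ballI)
    fix \<epsilon> x assume e: "\<epsilon> \<in> Zp p" and x: "x \<in> ?X"
    show "subdivision_map K f (realization_map (\<alpha> \<epsilon>) x)
      = realization_map (left_act p \<epsilon>) (subdivision_map K f x)"
    proof (rule subdivision_map_equivariant[OF fin inj[OF e] act[OF e]])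
      show "f (\<alpha> \<epsilon> ` \<sigma>) = left_act p \<epsilon> (f \<sigma>)" if "\<sigma> \<in> K" for \<sigma>
        using f(3) e that by (simp add: equivariant_def)
      show "{v. x v \<noteq> 0} \<in> K" using x by simp
    qed
  qed
qed

section \<open>The equivariant maps given by level and orientation\<close>

lemma Least_int_bounded_below:
  fixes P :: "int \<Rightarrow> bool"
  assumes "P k" and bound: "\<And>n. P n \<Longrightarrow> b \<le> n"
  shows "P (LEAST n. P n)" "\<And>n. P n \<Longrightarrow> (LEAST n. P n) \<le> n"
proof -
  define m where "m = (LEAST m::nat. P (b + int m))"
  have "P (b + int (nat (k - b)))" using assms(1) bound[OF assms(1)] by simp
  then have m: "P (b + int m)" unfolding m_def by (rule LeastI)
  have min: "b + int m \<le> n" if n: "P n" for n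
  proof -
    have "P (b + int (nat (n - b)))" using n bound[OF n] by simp
    then have "m \<le> nat (n - b)" unfolding m_def by (rule Least_le)
    then show ?thesis using bound[OF n] by linarith
  qed
  have "(LEAST n. P n) = b + int m" using m min by (rule Least_equality)
  then show "P (LEAST n. P n)" "\<And>n. P n \<Longrightarrow> (LEAST n. P n) \<le> n" using m min by simp_all
qed

lemma level_bound:
  assumes "hypergraph H" "complete_family r H (Zp p) U" "0 < p"
  shows "level p (\<lambda>j. c ` U j) \<le> p * card (verts H)"
proof -
  have "level p (\<lambda>j. c ` U j) \<le> (\<Sum>j\<in>Zp p. card (verts H))" unfolding level_def
  proof (rule sum_mono)
    fix j assume j: "j \<in> Zp p"
    have "card (c ` U j) \<le> card (U j)" using finite_part[OF assms(1,2) j] by (rule card_image_le)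
    also have "\<dots> \<le> card (verts H)"
      using assms(1,2) j
      by (intro card_mono) (auto simp: hypergraph_def complete_family_def partite_family_def)
    finally show "min (card (c ` U j)) (Suc (min_size p (\<lambda>j. c ` U j))) \<le> card (verts H)" by simp
  qed
  then show ?thesis using card_Zp[OF assms(3)] by simp
qed

lemma level_pos:
  assumes "0 < p" "\<forall>j\<in>Zp p. finite (A j)" "\<not> A constant_on Zp p"
  shows "0 < level p A"
proof (rule ccontr)
  assume "\<not> ?thesis"
  then have "\<forall>j\<in>Zp p. card (A j) = 0"
    using finite_Zp[OF assms(1)] by (auto simp: level_def min_def split: if_splits)
  then have "\<forall>j\<in>Zp p. A j = {}" using assms(2) by simp
  then show False using assms(3) by (auto simp: constant_on_def)
qed

text \<open>A simplex \<open>\<sigma>\<close> of the box complex is the disjoint union of its parts \<open>\<sigma> `` {j}\<close>.\<close>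

lemma box_complex_parts:
  assumes "\<sigma> \<in> box_complex r H p"
  shows "\<sigma> \<subseteq> Zp p \<times> verts H" "complete_family r H (Zp p) (\<lambda>j. \<sigma> `` {j})"
    "(\<Union>j\<in>Zp p. \<sigma> `` {j}) \<noteq> {}"
proof -
  obtain U where U: "\<sigma> = Sigma (Zp p) U" "complete_family r H (Zp p) U" "(\<Union>j\<in>Zp p. U j) \<noteq> {}"
    using assms by (auto simp: box_complex_def complete_family_def)
  have part: "\<sigma> `` {j} = U j" if "j \<in> Zp p" for j using that unfolding U(1) by auto
  show "\<sigma> \<subseteq> Zp p \<times> verts H"
    using U(1,2) unfolding complete_family_def partite_family_def by blast
  show "complete_family r H (Zp p) (\<lambda>j. \<sigma> `` {j})"
    using U(2) by (rule complete_family_mono) (simp add: part)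
  show "(\<Union>j\<in>Zp p. \<sigma> `` {j}) \<noteq> {}" using U(3) part by simp
qed

lemma box_complexI:
  assumes "\<sigma> \<subseteq> Zp p \<times> UNIV" "\<sigma> \<noteq> {}" "complete_family r H (Zp p) (\<lambda>j. \<sigma> `` {j})"
  shows "\<sigma> \<in> box_complex r H p"
proof -
  have "\<sigma> = Sigma (Zp p) (\<lambda>j. \<sigma> `` {j})" using assms(1) by auto
  moreover have "(\<Union>j\<in>Zp p. \<sigma> `` {j}) \<noteq> {}" using assms(1,2) by fastforce
  ultimately show ?thesis using assms(3) unfolding box_complex_def complete_family_def by blast
qed

lemma left_act_apply: "left_act p \<epsilon> (a, v) = ((\<epsilon> + a) mod int p, v)"
  by (simp add: left_act_def)

lemma inj_on_left_act:
  assumes "0 < p" shows "inj_on (left_act p \<epsilon>) (Zp p \<times> UNIV)"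
proof (rule inj_onI)
  fix x y assume "x \<in> Zp p \<times> (UNIV :: 'a set)" "y \<in> Zp p \<times> (UNIV :: 'a set)"
    and eq: "left_act p \<epsilon> x = left_act p \<epsilon> y"
  then obtain a v b w where xy: "x = (a, v)" "y = (b, w)" "a \<in> Zp p" "b \<in> Zp p" by auto
  have "(a + \<epsilon>) mod int p = (b + \<epsilon>) mod int p" "v = w"
    using eq by (simp_all add: xy left_act_apply add.commute)
  then show "x = y"
    using bij_betw_imp_inj_on[OF bij_betw_shift[OF assms, of \<epsilon>]] xy by (auto dest: inj_onD)
qed

lemma left_act_part:
  assumes "0 < p" "\<sigma> \<subseteq> Zp p \<times> UNIV" "j \<in> Zp p"
  shows "(left_act p \<epsilon> ` \<sigma>) `` {(j + \<epsilon>) mod int p} = \<sigma> `` {j}"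
proof -
  have "(left_act p \<epsilon> (j, v) \<in> left_act p \<epsilon> ` \<sigma>) = ((j, v) \<in> \<sigma>)" for v
    using inj_on_image_mem_iff[OF inj_on_left_act[OF assms(1)], of "(j, v)" \<sigma> \<epsilon>] assms(2,3) by simp
  then show ?thesis by (auto simp: left_act_apply add.commute)
qed

lemma left_act_box_complex:
  assumes "0 < p" "\<sigma> \<in> box_complex r H p"
  shows "left_act p \<epsilon> ` \<sigma> \<in> box_complex r H p"
proof (rule box_complexI)
  note \<sigma> = box_complex_parts[OF assms(2)]
  have \<sigma>Z: "\<sigma> \<subseteq> Zp p \<times> UNIV" using \<sigma>(1) by blast
  show "left_act p \<epsilon> ` \<sigma> \<subseteq> Zp p \<times> UNIV"
    using assms(1) by (auto simp: left_act_def Zp_eq split: prod.splits)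
  show "left_act p \<epsilon> ` \<sigma> \<noteq> {}" using \<sigma>(3) by auto
  have "complete_family r H (Zp p) (\<lambda>j. \<sigma> `` {(j + - \<epsilon>) mod int p})"
    using \<sigma>(2) bij_betw_shift[OF assms(1)] by (rule complete_family_reindex)
  then show "complete_family r H (Zp p) (\<lambda>j. (left_act p \<epsilon> ` \<sigma>) `` {j})"
  proof (rule complete_family_mono)
    fix j assume j: "j \<in> Zp p"
    let ?k = "(j + - \<epsilon>) mod int p"
    have "?k \<in> Zp p" using assms(1) by (simp add: Zp_eq)
    moreover have "(?k + \<epsilon>) mod int p = j"
      using j assms(1) by (simp add: Zp_eq mod_add_left_eq)
    ultimately show "(left_act p \<epsilon> ` \<sigma>) `` {j} \<subseteq> \<sigma> `` {?k}"
      using left_act_part[OF assms(1) \<sigma>Z, of ?k \<epsilon>] by simp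
  qed
qed

text \<open>The face poset of the box complex maps to the poset with layers \<open>1, \<dots>, n\<close> by orientation and
  level: growing a simplex raises the level or keeps both values, and rotating it shifts the
  orientation. Levels are positive because the colour sets are not all empty.\<close>

lemma ex_map_box_complex:
  assumes "Factorial_Ring.prime p" "r \<le> p" "hypergraph H" "proper_coloring H c"
    and bound: "\<And>U. complete_family r H (Zp p) U \<Longrightarrow> level p (\<lambda>j. c ` U j) \<le> n"
  shows "\<exists>F. continuous_map (realization (box_complex r H p)) (realization (E_complex p (int n - 1))) F \<and>
    equivariant p (topspace (realization (box_complex r H p))) (\<lambda>\<epsilon>. realization_map (left_act p \<epsilon>))
      (\<lambda>\<epsilon>. realization_map (left_act p \<epsilon>)) F"
proof -
  let ?K = "box_complex r H p"
  define A where "A = (\<lambda>\<sigma> j. c ` (\<sigma> `` {j :: int}))"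
  define f where "f = (\<lambda>\<sigma>. (orientation p (A \<sigma>), int (level p (A \<sigma>))))"
  have p: "0 < p" using assms(1) by (rule prime_gt_0_nat)
  have finV: "finite (Zp p \<times> verts H)"
    using assms(3) finite_Zp[OF p] by (simp add: hypergraph_def)
  have sub: "\<Union>?K \<subseteq> Zp p \<times> verts H" using box_complex_parts(1) by blast
  have finA: "\<forall>j\<in>Zp p. finite (A \<sigma> j)" if "\<sigma> \<in> ?K" for \<sigma>
    using finite_part[OF assms(3) box_complex_parts(2)[OF that]] by (simp add: A_def)
  have nc: "\<not> A \<sigma> constant_on Zp p" if "\<sigma> \<in> ?K" for \<sigma>
    unfolding A_def using box_complex_parts(2,3)[OF that] assms(2,4) p
    by (intro colours_nonconstant)
  show ?thesis
  proof (rule equivariant_realization_map_exists)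
    show "finite (\<Union>?K)" using sub finV by (rule finite_subset)
    then show "finite ?K" by (rule finite_UnionD)
    show "{} \<notin> ?K" using box_complex_parts(3) by force
    show "\<forall>\<sigma>\<in>?K. \<forall>\<tau>. \<tau> \<subseteq> \<sigma> \<longrightarrow> \<tau> \<noteq> {} \<longrightarrow> \<tau> \<in> ?K"
    proof (intro ballI allI impI)
      fix \<sigma> \<tau> assume \<sigma>: "\<sigma> \<in> ?K" and \<tau>: "\<tau> \<subseteq> \<sigma>" "\<tau> \<noteq> {}"
      show "\<tau> \<in> ?K"
      proof (rule box_complexI)
        show "\<tau> \<subseteq> Zp p \<times> UNIV" using \<tau>(1) box_complex_parts(1)[OF \<sigma>] by blast
        show "complete_family r H (Zp p) (\<lambda>j. \<tau> `` {j})"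
          using box_complex_parts(2)[OF \<sigma>] by (rule complete_family_mono) (use \<tau>(1) in blast)
      qed (rule \<tau>(2))
    qed
    show "inj_on (left_act p \<epsilon>) (\<Union>?K)" for \<epsilon>
      by (rule inj_on_subset[OF inj_on_left_act[OF p]]) (use sub in blast)
    show "left_act p \<epsilon> ` \<sigma> \<in> ?K" if "\<sigma> \<in> ?K" for \<epsilon> \<sigma>
      using p that by (rule left_act_box_complex)
    show "f \<in> ?K \<rightarrow> Q_poset p (int n - 1)"
    proof
      fix \<sigma> assume \<sigma>: "\<sigma> \<in> ?K"
      have "level p (A \<sigma>) \<le> n"
        unfolding A_def using box_complex_parts(2)[OF \<sigma>] by (rule bound)
      then show "f \<sigma> \<in> Q_poset p (int n - 1)"
        using orientation_in_Zp[OF assms(1) nc[OF \<sigma>]] level_pos[OF p finA nc, OF \<sigma> \<sigma>]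
        by (simp add: f_def Q_poset_def)
    qed
    show "monotone_on ?K (\<subseteq>) Q_le f"
    proof (rule monotone_onI)
      fix \<sigma> \<tau> assume st: "\<sigma> \<in> ?K" "\<tau> \<in> ?K" "\<sigma> \<subseteq> \<tau>"
      have A: "\<forall>j\<in>Zp p. A \<sigma> j \<subseteq> A \<tau> j" using st(3) by (auto simp: A_def)
      show "Q_le (f \<sigma>) (f \<tau>)"
        using level_mono[OF p finA[OF st(2)] A] orientation_eq_if_level_eq[OF p finA[OF st(2)] A]
        by (auto simp: Q_le_def f_def)
    qed
    show "equivariant p ?K (\<lambda>\<epsilon>. (`) (left_act p \<epsilon>)) (left_act p) f"
      unfolding equivariant_def
    proof (intro ballI)
      fix \<epsilon> \<sigma> assume \<sigma>: "\<sigma> \<in> ?K"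
      have \<sigma>Z: "\<sigma> \<subseteq> Zp p \<times> UNIV" using box_complex_parts(1)[OF \<sigma>] by blast
      have sh: "\<forall>j\<in>Zp p. A (left_act p \<epsilon> ` \<sigma>) ((j + \<epsilon>) mod int p) = A \<sigma> j"
        unfolding A_def by (intro ballI arg_cong[where f = "(`) c"] left_act_part[OF p \<sigma>Z])
      show "f (left_act p \<epsilon> ` \<sigma>) = left_act p \<epsilon> (f \<sigma>)"
        unfolding f_def left_act_apply
        using level_shift[of p "A (left_act p \<epsilon> ` \<sigma>)" \<epsilon> "A \<sigma>", OF p sh]
          orientation_shift[of p "A \<sigma>" "A (left_act p \<epsilon> ` \<sigma>)" \<epsilon>, OF assms(1) nc[OF \<sigma>] sh]
        by (simp add: add.commute)
    qed
  qed
qed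

text \<open>Here all parts are nonempty, so levels start at \<open>p\<close> and are lowered by \<open>p - 1\<close>. The group
  acts on the index of the parts from the opposite side compared to the box complex, which the
  sign of the orientation compensates.\<close>

lemma ex_map_Hom_poset:
  assumes "Factorial_Ring.prime p" "r \<le> p" "hypergraph H" "proper_coloring H c"
    and bound: "\<And>U. complete_family r H (Zp p) U \<Longrightarrow> level p (\<lambda>j. c ` U j) \<le> n"
  shows "\<exists>f \<in> Hom_poset r H p \<rightarrow> Q_poset p (int n - int p).
    monotone_on (Hom_poset r H p) (Hom_le p) Q_le f \<and>
    equivariant p (Hom_poset r H p) (Hom_act p) (left_act p) f"
proof -
  let ?P = "Hom_poset r H p"
  define A where "A = (\<lambda>U (j::int). c ` U j)"
  define f where "f = (\<lambda>U. ((- orientation p (A U)) mod int p, int (level p (A U)) - int p + 1))"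
  have p: "0 < p" using assms(1) by (rule prime_gt_0_nat)
  have cf: "complete_family r H (Zp p) U" and ne: "\<forall>j\<in>Zp p. U j \<noteq> {}" if "U \<in> ?P" for U
    using that by (auto simp: Hom_poset_def complete_family_def)
  have finA: "\<forall>j\<in>Zp p. finite (A U j)" if "U \<in> ?P" for U
    using finite_part[OF assms(3) cf[OF that]] by (simp add: A_def)
  have nc: "\<not> A U constant_on Zp p" if "U \<in> ?P" for U
    unfolding A_def
  proof (rule colours_nonconstant[OF cf[OF that] assms(4) p assms(2)])
    show "(\<Union>j\<in>Zp p. U j) \<noteq> {}" using ne[OF that] p by (auto simp: Zp_eq)
  qed
  have ge: "p \<le> level p (A U)" if "U \<in> ?P" for U
  proof -
    obtain j where j: "j \<in> Zp p" "card (A U j) = min_size p (A U)"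
      using min_size_attained[OF p] by blast
    have "A U j \<noteq> {}" using ne[OF that] j(1) by (simp add: A_def)
    then have "1 \<le> min_size p (A U)"
      using finA[OF that] j(1) unfolding j(2)[symmetric] by (simp add: Suc_le_eq card_gt_0_iff)
    then have "p * 1 \<le> p * min_size p (A U)" by (rule mult_le_mono2)
    then show ?thesis using level_ge[OF p, of "A U"] by linarith
  qed
  have "f \<in> ?P \<rightarrow> Q_poset p (int n - int p)"
  proof
    fix U assume U: "U \<in> ?P"
    have "level p (A U) \<le> n" unfolding A_def using cf[OF U] by (rule bound)
    then show "f U \<in> Q_poset p (int n - int p)"
      using ge[OF U] p by (simp add: f_def Q_poset_def Zp_eq)
  qed
  moreover have "monotone_on ?P (Hom_le p) Q_le f"
  proof (rule monotone_onI)
    fix U W assume UW: "U \<in> ?P" "W \<in> ?P" "Hom_le p U W"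
    have A: "\<forall>j\<in>Zp p. A U j \<subseteq> A W j" using UW(3) by (auto simp: A_def Hom_le_def)
    show "Q_le (f U) (f W)"
      using level_mono[OF p finA[OF UW(2)] A] orientation_eq_if_level_eq[OF p finA[OF UW(2)] A]
      by (auto simp: Q_le_def f_def)
  qed
  moreover have "equivariant p ?P (Hom_act p) (left_act p) f"
    unfolding equivariant_def
  proof (intro ballI)
    fix \<epsilon> U assume U: "U \<in> ?P"
    have sh: "\<forall>j\<in>Zp p. A (Hom_act p \<epsilon> U) ((j + - \<epsilon>) mod int p) = A U j"
      using p by (simp add: A_def Hom_act_def Zp_eq mod_add_left_eq mod_diff_left_eq)
    have "orientation p (A (Hom_act p \<epsilon> U)) = (orientation p (A U) + - \<epsilon>) mod int p"
      using assms(1) nc[OF U] sh by (rule orientation_shift)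
    then have "(- orientation p (A (Hom_act p \<epsilon> U))) mod int p
      = (\<epsilon> + (- orientation p (A U)) mod int p) mod int p"
      by (simp add: mod_minus_eq mod_add_right_eq)
    moreover have "level p (A (Hom_act p \<epsilon> U)) = level p (A U)"
      using p sh by (rule level_shift)
    ultimately show "f (Hom_act p \<epsilon> U) = left_act p \<epsilon> (f U)"
      by (simp add: f_def left_act_apply)
  qed
  ultimately show ?thesis by blast
qed

section \<open>Colourful subhypergraphs and the chromatic number\<close>

lemma level_less_if_no_colourful:
  assumes "0 < p" "\<not> has_colorful_balanced_complete_partite r H c p (int N)"
    and "complete_family r H (Zp p) U"
  shows "level p (\<lambda>j. c ` U j) < N"
  using colourful_subfamily[OF assms(3,1)] assms(2) by (meson not_le)

lemma complete_family_empty: "0 < r \<Longrightarrow> complete_family r H I (\<lambda>_. {})"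
  by (auto simp: complete_family_def partite_family_def complete_partite_def disjoint_family_on_def)

text \<open>If no colourful balanced subhypergraph has \<open>N\<close> vertices, all levels are at most \<open>N - 1\<close>, and
  the map by orientation and level shows that the index is less than \<open>N - 1\<close>. The trivial bound on
  levels guarantees that the index is the minimum of a nonempty set.\<close>

theorem colourful_partite_ind_box:
  assumes "0 < r" "Factorial_Ring.prime p" "r \<le> p" "hypergraph H" "proper_coloring H c"
  shows "has_colorful_balanced_complete_partite r H c p (ind_box r H p + 1)"
proof (rule ccontr)
  let ?K = "box_complex r H p"
  define P where "P = (\<lambda>n::int. n \<ge> -1 \<and>
    (\<exists>F. continuous_map (realization ?K) (realization (E_complex p n)) F \<and>
      equivariant p (topspace (realization ?K)) (\<lambda>\<epsilon>. realization_map (left_act p \<epsilon>))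
        (\<lambda>\<epsilon>. realization_map (left_act p \<epsilon>)) F))"
  have p: "0 < p" using assms(2) by (rule prime_gt_0_nat)
  have ind: "ind_box r H p = (LEAST n. P n)"
    by (simp add: ind_box_def complex_index_def Zp_index_def P_def)
  have PI: "P (int n - 1)"
    if "\<And>U. complete_family r H (Zp p) U \<Longrightarrow> level p (\<lambda>j. c ` U j) \<le> n" for n
    using ex_map_box_complex[OF assms(2-5) that] by (simp add: P_def)
  have ge: "-1 \<le> n" if "P n" for n using that by (simp add: P_def)
  have least: "P (ind_box r H p)" "ind_box r H p \<le> n" if "P n" for n
    unfolding ind
    using Least_int_bounded_below[where P = P and b = "-1", OF that ge] that by simp_all
  have "P (int (p * card (verts H)) - 1)" using level_bound[OF assms(4) _ p] by (rule PI)
  then have lower: "-1 \<le> ind_box r H p" using least(1) ge by blast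
  define N where "N = nat (ind_box r H p + 1)"
  have N: "ind_box r H p + 1 = int N" using lower p by (simp add: N_def)
  assume "\<not> has_colorful_balanced_complete_partite r H c p (ind_box r H p + 1)"
  then have less: "level p (\<lambda>j. c ` U j) < N" if "complete_family r H (Zp p) U" for U
    using level_less_if_no_colourful[OF p _ that] N by simp
  have "0 < N" using less[OF complete_family_empty[OF assms(1)]] by simp
  have "level p (\<lambda>j. c ` U j) \<le> N - 1" if "complete_family r H (Zp p) U" for U
    using less[OF that] by simp
  then have "P (int (N - 1) - 1)" by (rule PI)
  then have "ind_box r H p \<le> int (N - 1) - 1" by (rule least(2))
  then show False using N \<open>0 < N\<close> by linarith
qed

text \<open>The vertices of a complete subhypergraph form singleton parts.\<close>

lemma Hom_poset_nonempty:
  assumes "0 < r" "0 < p" "hypergraph H" "p \<le> clique_number r H"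
  shows "Hom_poset r H p \<noteq> {}"
proof -
  define S where "S = {n. contains_subhypergraph H (complete_hypergraph r n)}"
  have fin: "finite (verts H)" using assms(3) by (simp add: hypergraph_def)
  have "S \<subseteq> {..card (verts H)}"
  proof
    fix n assume "n \<in> S"
    then obtain f where "f ` {1..n} \<subseteq> verts H" "inj_on f {1..n}"
      by (auto simp: S_def contains_subhypergraph_def complete_hypergraph_def)
    then have "card {1..n} \<le> card (verts H)" using fin by (intro card_inj_on_le)
    then show "n \<in> {..card (verts H)}" by simp
  qed
  then have "finite S" using finite_subset by blast
  moreover have "0 \<in> S"
    using assms(1) by (auto simp: S_def contains_subhypergraph_def complete_hypergraph_def)
  ultimately have "clique_number r H \<in> S"
    unfolding clique_number_def S_def[symmetric] by (intro Max_in) auto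
  then obtain f where f: "f ` {1..clique_number r H} \<subseteq> verts H" "inj_on f {1..clique_number r H}"
    "\<forall>X. X \<subseteq> {1..clique_number r H} \<and> card X = r \<longrightarrow> f ` X \<in> edges H"
    by (auto simp: S_def contains_subhypergraph_def complete_hypergraph_def)
  have sub: "{1..p} \<subseteq> {1..clique_number r H}" using assms(4) by auto
  have inj: "inj_on f {1..p}" using f(2) sub by (rule inj_on_subset)
  define U where "U = (\<lambda>i. {f i})"
  have "complete_family r H {1..p} U" unfolding complete_family_def
  proof
    have "f i \<in> verts H" if "i \<in> {1..p}" for i using f(1) sub that by blast
    then show "partite_family H {1..p} U"
      using inj by (simp add: partite_family_def disjoint_family_on_def U_def inj_on_eq_iff)
    show "complete_partite r H {1..p} U" unfolding complete_partite_def
    proof (intro allI impI)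
      fix e assume e: "e \<subseteq> (\<Union>i\<in>{1..p}. U i) \<and> card e = r \<and> (\<forall>i\<in>{1..p}. card (e \<inter> U i) \<le> 1)"
      then have "e \<subseteq> f ` {1..p}" by (auto simp: U_def)
      then obtain X where X: "X \<subseteq> {1..p}" "e = f ` X" by (auto simp: subset_image_iff)
      then have "card X = r" using e card_image[OF inj_on_subset[OF inj X(1)]] by simp
      moreover have "X \<subseteq> {1..clique_number r H}" using X(1) sub by (rule subset_trans)
      ultimately have "e \<in> edges H" using f(3) X(2) by blast
      then show "e \<in> edges (partite_sub H {1..p} U)" using e by (simp add: partite_sub_def)
    qed
  qed
  moreover have "bij_betw (\<lambda>j. nat (j + 1)) (Zp p) {1..p}"
    by (rule bij_betw_byWitness[where f' = "\<lambda>i. int i - 1"]) (use assms(2) in \<open>auto simp: Zp_eq\<close>)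
  ultimately have "complete_family r H (Zp p) (\<lambda>j. U (nat (j + 1)))" by (rule complete_family_reindex)
  then have "complete_family r H (Zp p) (restrict (\<lambda>j. U (nat (j + 1))) (Zp p))"
    by (rule complete_family_mono) simp
  then have "restrict (\<lambda>j. U (nat (j + 1))) (Zp p) \<in> Hom_poset r H p"
    by (simp add: Hom_poset_def complete_family_def U_def)
  then show ?thesis by blast
qed

theorem colourful_partite_Xind_Hom:
  assumes "0 < r" "Factorial_Ring.prime p" "r \<le> p" "hypergraph H" "proper_coloring H c"
    and "p \<le> clique_number r H"
  shows "has_colorful_balanced_complete_partite r H c p (Xind_Hom r H p + int p)"
proof (rule ccontr)
  let ?P = "Hom_poset r H p"
  define P where "P = (\<lambda>n::int. n \<ge> -1 \<and>
    (\<exists>f \<in> ?P \<rightarrow> Q_poset p n. monotone_on ?P (Hom_le p) Q_le f \<and>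
      equivariant p ?P (Hom_act p) (left_act p) f))"
  have p: "0 < p" using assms(2) by (rule prime_gt_0_nat)
  have ind: "Xind_Hom r H p = (LEAST n. P n)"
    by (simp add: Xind_Hom_def cross_index_def P_def)
  have PI: "P (int n - int p)"
    if bound: "\<And>U. complete_family r H (Zp p) U \<Longrightarrow> level p (\<lambda>j. c ` U j) \<le> n" for n
  proof -
    obtain f where f: "f \<in> ?P \<rightarrow> Q_poset p (int n - int p)"
      "monotone_on ?P (Hom_le p) Q_le f" "equivariant p ?P (Hom_act p) (left_act p) f"
      using ex_map_Hom_poset[OF assms(2-5) bound] by blast
    obtain U where "U \<in> ?P" using Hom_poset_nonempty[OF assms(1) p assms(4,6)] by blast
    \<comment> \<open>A map from a nonempty poset forces its target to be nonempty.\<close>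
    then have "f U \<in> Q_poset p (int n - int p)" using f(1) by blast
    then have "0 \<le> int n - int p" by (auto simp: Q_poset_def)
    then show ?thesis using f by (auto simp: P_def)
  qed
  have ge: "-1 \<le> n" if "P n" for n using that by (simp add: P_def)
  have least: "P (Xind_Hom r H p)" "Xind_Hom r H p \<le> n" if "P n" for n
    unfolding ind
    using Least_int_bounded_below[where P = P and b = "-1", OF that ge] that by simp_all
  have "P (int (p * card (verts H)) - int p)" using level_bound[OF assms(4) _ p] by (rule PI)
  then have lower: "-1 \<le> Xind_Hom r H p" using least(1) ge by blast
  define N where "N = nat (Xind_Hom r H p + int p)"
  have N: "Xind_Hom r H p + int p = int N" using lower p by (simp add: N_def)
  assume "\<not> has_colorful_balanced_complete_partite r H c p (Xind_Hom r H p + int p)"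
  then have less: "level p (\<lambda>j. c ` U j) < N" if "complete_family r H (Zp p) U" for U
    using level_less_if_no_colourful[OF p _ that] N by simp
  have "0 < N" using less[OF complete_family_empty[OF assms(1)]] by simp
  have "level p (\<lambda>j. c ` U j) \<le> N - 1" if "complete_family r H (Zp p) U" for U
    using less[OF that] by simp
  then have "P (int (N - 1) - int p)" by (rule PI)
  then have "Xind_Hom r H p \<le> int (N - 1) - int p" by (rule least(2))
  then show False using N \<open>0 < N\<close> by linarith
qed

text \<open>Apply the existence statement to an optimal colouring.\<close>

lemma chromatic_number_ge:
  assumes "2 \<le> r" "c \<in> verts H \<rightarrow> {1..C}" "proper_coloring H c"
    and has: "\<And>c. proper_coloring H c \<Longrightarrow> has_colorful_balanced_complete_partite r H c p N"
  shows "real (chromatic_number H) \<ge> real_of_int N / (real r - 1)"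
proof -
  obtain c' where c': "c' \<in> verts H \<rightarrow> {1..chromatic_number H}" "proper_coloring H c'"
    using assms(2,3) by (rule chromatic_number_attained)
  have "N \<le> int (chromatic_number H * (r - 1))"
    using has[OF c'(2)] c'(2,1) by (rule colourful_vertices_le)
  then have "real_of_int N \<le> real_of_int (int (chromatic_number H * (r - 1)))"
    by (simp only: of_int_le_iff)
  also have "\<dots> = real (chromatic_number H) * (real r - 1)" using assms(1) by (simp add: of_nat_diff)
  finally show ?thesis using assms(1) by (simp add: divide_le_eq)
qed

theorem theorem1:
  fixes r p C :: nat
    and H :: "'v hypergraph"
    and c :: "'v \<Rightarrow> nat"
  assumes "r \<ge> 2"
    and "Factorial_Ring.prime p" and "p \<ge> r"
    and "hypergraph H" and "uniform r H"
    and "C \<ge> 1" and "c \<in> verts H \<rightarrow> {1..C}" and "proper_coloring H c"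
  shows
    "(has_colorful_balanced_complete_partite r H c p (ind_box r H p + 1) \<and>
      real (chromatic_number H) \<ge> real_of_int (ind_box r H p + 1) / (real r - 1)) \<and>
     (p \<le> clique_number r H \<longrightarrow>
      has_colorful_balanced_complete_partite r H c p (Xind_Hom r H p + int p) \<and>
      real (chromatic_number H) \<ge> real_of_int (Xind_Hom r H p + int p) / (real r - 1))"
proof (intro conjI impI)
  have r: "0 < r" using assms(1) by simp
  have box: "has_colorful_balanced_complete_partite r H c p (ind_box r H p + 1)"
    if "proper_coloring H c" for c
    using r assms(2,3,4) that by (rule colourful_partite_ind_box)
  show "has_colorful_balanced_complete_partite r H c p (ind_box r H p + 1)"
    using assms(8) by (rule box)
  show "real (chromatic_number H) \<ge> real_of_int (ind_box r H p + 1) / (real r - 1)"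
    using assms(1,7,8) box by (rule chromatic_number_ge)
  assume \<omega>: "p \<le> clique_number r H"
  have hom: "has_colorful_balanced_complete_partite r H c p (Xind_Hom r H p + int p)"
    if "proper_coloring H c" for c
    using r assms(2,3,4) that \<omega> by (rule colourful_partite_Xind_Hom)
  show "has_colorful_balanced_complete_partite r H c p (Xind_Hom r H p + int p)"
    using assms(8) by (rule hom)
  show "real (chromatic_number H) \<ge> real_of_int (Xind_Hom r H p + int p) / (real r - 1)"
    using assms(1,7,8) hom by (rule chromatic_number_ge)
qed

end
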